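(* Let $T=(V,E)$ be a finite tree with at least one edge and let $w(t)$, $t\ge0$, be a solution of the normalized inverse-weight Ricci flow with positive initial metric. Assume that $\mathcal S_{E_*}(c_* )\ne\varnothing$. Then $w(t)$ converges as $t\to\infty$ to a limit $w^\infty$ whose positive support $\{e:w_e^\infty>0\}$ is exactly $E_*$. Moreover, $w^\infty|_{E_*}\in\mathcal S_{E_*}(c_* )$, and $$\lim_{t\to\infty}\frac{w_e(t)}{w_f(t)}=\frac{w_e^\infty}{w_f^\infty}\in(0,\infty)\qquad(e,f\in E_* ).$$ (No connectedness assumption on the graph $G_{E_*}$ is required.) In particular, if one omega-limit point of $w$ has positive support $E_*$, then the whole trajectory converges to that omega-limit point.
   Context: $T=(V,E)$ is a finite tree with at least one edge; $d_x$ is the combinatorial degree of $x\in V$ and $E(x)$ the set of edges incident to $x$. A positive metric is $w=(w_e)_{e\in E}$ with all $w_e>0$; it induces the path metric $d_w$ on $V$. Put $D_x(w)=\sum_{e\ni x}1/w_e$. For $\alpha\in[0,1)$ let $m_x^\alpha(x)=\alpha$ and $m_x^\alpha(z)=(1-\alpha)\,w_{xz}^{-1}/D_x(w)$ for $z\sim x$. The (inverse-weight) Lin--Lu--Yau curvature of $e=xy$ is $\kappa_e(w)=\lim_{\alpha\uparrow1}\frac{1-W_1(m_x^\alpha,m_y^\alpha)/w_e}{1-\alpha}$, with $W_1$ the $1$-Wasserstein distance for $d_w$. Known formula on trees: $\kappa_{xy}(w)=\frac{2-d_x}{w_{xy}D_x(w)}+\frac{2-d_y}{w_{xy}D_y(w)}$.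 The normalized flow is $\dot w_e=-w_e(\kappa_e(w)-K(w))$, $K(w)=\sum_f w_f\kappa_f(w)$, with $w_e(0)>0$ and $\sum_e w_e(0)=1$ (this sum is preserved). For every positive initial metric the limits $c_e=\lim_{t\to\infty}\kappa_e(w(t))$ exist; put $c_*=\min_e c_e$ and $E_*=\{e\in E:c_e=c_*\}$. An omega-limit point of $w$ is a point $w^*\in\{q\in\mathbb R^E:q_e\ge0,\sum_e q_e=1\}$ such that $w(t_j)\to w^*$ for some sequence $t_j\to\infty$; its positive support is $E^+(w^* )=\{e\in E:w^*_e>0\}$. For nonempty $C\subseteq E$ let $\Delta_C=\{p\in\mathbb R^C:p_e>0\ \forall e\in C,\ \sum_{e\in C}p_e=1\}$. For $p\in\Delta_C$ and $e\in C$ put $$\kappa_e^C(p)=\sum_{x\in e,\ E(x)\subseteq C}\frac{2-d_x}{p_e\sum_{f\in E(x)}p_f^{-1}},$$ and for $c\in\mathbb R$ let $\mathcal S_C(c)=\{p\in\Delta_C:\kappa_e^C(p)=c\text{ for every }e\in C\}$. $G_C$ is the graph whose vertices are the edges in $C$, two of them being adjacent if they meet at a vertex $x$ with $d_x\ge3$ and $E(x)\subseteq C$. *)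

theory Defs
  imports Complex_Main "HOL-Library.FuncSet"
begin

(* Finite simple graphs: vertex set V, edges are two-element subsets of V.  Points of R^E are
   functions on edges, of which only the values on E matter. *)

definition finite_graph :: "'a set \<Rightarrow> 'a set set \<Rightarrow> bool" where
  "finite_graph V E \<longleftrightarrow> finite V \<and> (\<forall>e\<in>E. \<exists>x\<in>V. \<exists>y\<in>V. x \<noteq> y \<and> e = {x, y})"

definition is_walk :: "'a set set \<Rightarrow> 'a list \<Rightarrow> bool" where
  "is_walk E xs \<longleftrightarrow> xs \<noteq> [] \<and> successively (\<lambda>x y. {x, y} \<in> E) xs"

definition walks :: "'a set set \<Rightarrow> 'a \<Rightarrow> 'a \<Rightarrow> 'a list set" where
  "walks E x y = {xs. is_walk E xs \<and> hd xs = x \<and> last xs = y}"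

definition is_cycle :: "'a set set \<Rightarrow> 'a list \<Rightarrow> bool" where
  "is_cycle E xs \<longleftrightarrow> is_walk E xs \<and> distinct xs \<and> 3 \<le> length xs \<and> {last xs, hd xs} \<in> E"

definition finite_tree :: "'a set \<Rightarrow> 'a set set \<Rightarrow> bool" where
  "finite_tree V E \<longleftrightarrow> finite_graph V E \<and> V \<noteq> {} \<and>
     (\<forall>x\<in>V. \<forall>y\<in>V. walks E x y \<noteq> {}) \<and> (\<nexists>xs. is_cycle E xs)"

definition incident :: "'a set set \<Rightarrow> 'a \<Rightarrow> 'a set set" where
  "incident E x = {e \<in> E. x \<in> e}"

definition degree :: "'a set set \<Rightarrow> 'a \<Rightarrow> nat" where
  "degree E x = card (incident E x)"

definition walk_length :: "('a set \<Rightarrow> real) \<Rightarrow> 'a list \<Rightarrow> real" where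
  "walk_length w xs = (\<Sum>(x, y) \<leftarrow> zip xs (tl xs). w {x, y})"

definition path_dist :: "'a set set \<Rightarrow> ('a set \<Rightarrow> real) \<Rightarrow> 'a \<Rightarrow> 'a \<Rightarrow> real" where
  "path_dist E w x y = (INF xs \<in> walks E x y. walk_length w xs)"

definition couplings :: "'a set \<Rightarrow> ('a \<Rightarrow> real) \<Rightarrow> ('a \<Rightarrow> real) \<Rightarrow> ('a \<Rightarrow> 'a \<Rightarrow> real) set" where
  "couplings V \<mu> \<nu> = {\<pi>. (\<forall>x\<in>V. \<forall>y\<in>V. 0 \<le> \<pi> x y) \<and>
     (\<forall>x\<in>V. (\<Sum>y\<in>V. \<pi> x y) = \<mu> x) \<and> (\<forall>y\<in>V. (\<Sum>x\<in>V. \<pi> x y) = \<nu> y)}"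

definition wasserstein1 ::
  "'a set \<Rightarrow> ('a \<Rightarrow> 'a \<Rightarrow> real) \<Rightarrow> ('a \<Rightarrow> real) \<Rightarrow> ('a \<Rightarrow> real) \<Rightarrow> real" where
  "wasserstein1 V d \<mu> \<nu> = (INF \<pi> \<in> couplings V \<mu> \<nu>. \<Sum>x\<in>V. \<Sum>y\<in>V. d x y * \<pi> x y)"

definition inv_weight_sum :: "'a set set \<Rightarrow> ('a set \<Rightarrow> real) \<Rightarrow> 'a \<Rightarrow> real" where
  "inv_weight_sum E w x = (\<Sum>e\<in>incident E x. 1 / w e)"

definition lazy_measure :: "'a set set \<Rightarrow> ('a set \<Rightarrow> real) \<Rightarrow> real \<Rightarrow> 'a \<Rightarrow> 'a \<Rightarrow> real" where
  "lazy_measure E w \<alpha> x z =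
     (if z = x then \<alpha>
      else if {x, z} \<in> E then (1 - \<alpha>) * (1 / w {x, z}) / inv_weight_sum E w x
      else 0)"

definition lly_curvature :: "'a set \<Rightarrow> 'a set set \<Rightarrow> ('a set \<Rightarrow> real) \<Rightarrow> 'a \<Rightarrow> 'a \<Rightarrow> real" where
  "lly_curvature V E w x y =
     Lim (at_left 1) (\<lambda>\<alpha>.
       (1 - wasserstein1 V (path_dist E w) (lazy_measure E w \<alpha> x) (lazy_measure E w \<alpha> y) / w {x, y})
       / (1 - \<alpha>))"

(* The curvature of x y is symmetric in x and y, so the description below does not depend on
   the chosen orientation of e (and is determined uniquely). *)
definition curv :: "'a set \<Rightarrow> 'a set set \<Rightarrow> ('a set \<Rightarrow> real) \<Rightarrow> 'a set \<Rightarrow> real" where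
  "curv V E w e = (THE k. \<exists>x y. e = {x, y} \<and> k = lly_curvature V E w x y)"

definition mean_curv :: "'a set \<Rightarrow> 'a set set \<Rightarrow> ('a set \<Rightarrow> real) \<Rightarrow> real" where
  "mean_curv V E w = (\<Sum>f\<in>E. w f * curv V E w f)"

(* The phase space consists of the positive metrics, so positivity at all times t \<ge> 0 is part of
   being a solution.  At t = 0 the derivative is one-sided. *)
definition normalized_flow ::
  "'a set \<Rightarrow> 'a set set \<Rightarrow> (real \<Rightarrow> 'a set \<Rightarrow> real) \<Rightarrow> bool" where
  "normalized_flow V E w \<longleftrightarrow>
     (\<forall>t\<ge>0. \<forall>e\<in>E. 0 < w t e) \<and>
     (\<Sum>e\<in>E. w 0 e) = 1 \<and>
     (\<forall>t\<ge>0. \<forall>e\<in>E. ((\<lambda>s. w s e) has_real_derivative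
        - w t e * (curv V E (w t) e - mean_curv V E (w t))) (at t within {0..}))"

definition lim_curv :: "'a set \<Rightarrow> 'a set set \<Rightarrow> (real \<Rightarrow> 'a set \<Rightarrow> real) \<Rightarrow> 'a set \<Rightarrow> real" where
  "lim_curv V E w e = Lim at_top (\<lambda>t. curv V E (w t) e)"

definition min_lim_curv :: "'a set \<Rightarrow> 'a set set \<Rightarrow> (real \<Rightarrow> 'a set \<Rightarrow> real) \<Rightarrow> real" where
  "min_lim_curv V E w = Min (lim_curv V E w ` E)"

definition min_edges :: "'a set \<Rightarrow> 'a set set \<Rightarrow> (real \<Rightarrow> 'a set \<Rightarrow> real) \<Rightarrow> 'a set set" where
  "min_edges V E w = {e \<in> E. lim_curv V E w e = min_lim_curv V E w}"

definition pos_support :: "'a set set \<Rightarrow> ('a set \<Rightarrow> real) \<Rightarrow> 'a set set" where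
  "pos_support E q = {e \<in> E. 0 < q e}"

definition omega_limit_point ::
  "'a set set \<Rightarrow> (real \<Rightarrow> 'a set \<Rightarrow> real) \<Rightarrow> ('a set \<Rightarrow> real) \<Rightarrow> bool" where
  "omega_limit_point E w q \<longleftrightarrow>
     (\<forall>e\<in>E. 0 \<le> q e) \<and> (\<Sum>e\<in>E. q e) = 1 \<and>
     (\<exists>\<tau> :: nat \<Rightarrow> real. filterlim \<tau> at_top sequentially \<and>
        (\<forall>e\<in>E. (\<lambda>j. w (\<tau> j) e) \<longlonglongrightarrow> q e))"

definition open_simplex :: "'a set set \<Rightarrow> ('a set \<Rightarrow> real) set" where
  "open_simplex C = {p \<in> C \<rightarrow>\<^sub>E {0<..}. (\<Sum>e\<in>C. p e) = 1}"

definition face_curv :: "'a set set \<Rightarrow> 'a set set \<Rightarrow> ('a set \<Rightarrow> real) \<Rightarrow> 'a set \<Rightarrow> real" where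
  "face_curv E C p e =
     (\<Sum>x | x \<in> e \<and> incident E x \<subseteq> C. (2 - real (degree E x)) / (p e * (\<Sum>f\<in>incident E x. 1 / p f)))"

definition const_curv_set :: "'a set set \<Rightarrow> 'a set set \<Rightarrow> real \<Rightarrow> ('a set \<Rightarrow> real) set" where
  "const_curv_set E C c = {p \<in> open_simplex C. \<forall>e\<in>C. face_curv E C p e = c}"

end

theory Submission
  imports Defs
begin

text \<open>On a tree the curvature of an edge \<open>xy\<close> is computed by an explicit optimal coupling, certified by
  the potential \<open>w\<^sub>x\<^sub>y + d(x, \<cdot>)\<close> on the side of \<open>x\<close> and \<open>- d(y, \<cdot>)\<close> on the side of \<open>y\<close>.  In the
  coordinates \<open>u = ln w\<close> the resulting formula says that \<open>\<kappa>\<close> is the gradient of the convex function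
  \<open>\<Sum>\<^sub>x (d\<^sub>x - 2) ln (\<Sum>\<^sub>f exp (- u\<^sub>f))\<close>, where \<open>f\<close> ranges over the edges at \<open>x\<close>, and up to
  normalization the flow is its gradient flow, so that the curvatures converge.  Edges of minimal
  limiting curvature outgrow all the others exponentially.  Hence on them the flow becomes a gradient
  flow of the potential of the face with an integrable error, whose distance to every stationary point
  (a constant curvature metric on the face, in logarithmic coordinates) is almost nonincreasing:
  existence of one stationary point gives boundedness, and an accumulation point is a stationary
  point to which the flow must converge.\<close>

section \<open>The curvature of an edge of a tree\<close>

text \<open>On a tree with an edge the curvatures always sum to 2, so the potential has no critical
  point and the logarithmic coordinates diverge: on the whole tree only the gradient can be expected
  to converge. Equal limits of curvature inside the minimal face still allow ratios of weights to
  drift sublinearly. A constant curvature metric on the face rules this out, since monotonicity of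
  the gradient makes it a centre from which the trajectory cannot escape. This centre need not be
  the limit: when G_C is disconnected, its components can be rescaled separately without changing
  any curvature of the face, so stationary points may differ by more than a common factor. Hence the
  distance estimate is used twice, with the given metric as centre for boundedness and with an
  accumulation point as centre for convergence. A vertex counts for the face only if all its edges
  lie in it, because at any other vertex an edge of negligible weight dominates the sum of inverse
  weights.\<close>

lemma edge_endpoints:
  assumes "finite_graph V E" "{x, y} \<in> E"
  shows "x \<in> V" "y \<in> V" "x \<noteq> y"
proof -
  obtain a b where "a \<in> V" "b \<in> V" "a \<noteq> b" "{x, y} = {a, b}"
    using assms unfolding finite_graph_def by blast
  then show "x \<in> V" "y \<in> V" "x \<noteq> y" by (auto simp: doubleton_eq_iff)
qed

section \<open>Walks, bridges and the path metric\<close>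

lemma is_walk_Cons: "is_walk E (x # xs) \<longleftrightarrow> xs = [] \<or> ({x, hd xs} \<in> E \<and> is_walk E xs)"
  by (cases xs) (auto simp: is_walk_def)

lemma is_walk_append_edge:
  assumes "is_walk E xs" "{last xs, z} \<in> E"
  shows "is_walk E (xs @ [z])"
  using assms by (auto simp: is_walk_def successively_append_iff)

lemma walk_length_singleton [simp]: "walk_length w [x] = 0"
  by (simp add: walk_length_def)

lemma walk_length_Cons:
  "xs \<noteq> [] \<Longrightarrow> walk_length w (x # xs) = w {x, hd xs} + walk_length w xs"
  by (cases xs) (auto simp: walk_length_def)

lemma walk_length_snoc:
  "xs \<noteq> [] \<Longrightarrow> walk_length w (xs @ [z]) = walk_length w xs + w {last xs, z}"
proof (induction xs)
  case (Cons a xs)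
  then show ?case by (cases "xs = []") (auto simp: walk_length_Cons)
qed simp

lemma walk_length_nonneg:
  assumes "\<forall>e\<in>E. 0 \<le> w e" "is_walk E xs"
  shows "0 \<le> walk_length w xs"
  using assms(2)
proof (induction xs)
  case (Cons a xs)
  then show ?case
    using assms(1) by (cases "xs = []") (auto simp: walk_length_Cons is_walk_Cons)
qed (simp add: is_walk_def)

text \<open>Telescoping along the walk. This lifts a Lipschitz condition from edges to the path
  metric, which turns \<open>f\<close> into a dual certificate for transport costs.\<close>

lemma walk_potential_bound:
  assumes "\<And>a b. {a, b} \<in> E \<Longrightarrow> f a - f b \<le> w {a, b}" "is_walk E xs"
  shows "f (hd xs) - f (last xs) \<le> walk_length w xs"
  using assms(2)
proof (induction xs)
  case (Cons a xs)
  show ?case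
  proof (cases "xs = []")
    case False
    then have "{a, hd xs} \<in> E" "is_walk E xs" using Cons.prems by (auto simp: is_walk_Cons)
    then show ?thesis
      using Cons.IH assms(1)[of a "hd xs"] False by (simp add: walk_length_Cons)
  qed simp
qed (simp add: is_walk_def)

text \<open>Cutting out the loop between two visits of \<open>z\<close> shortens the walk.
  Distinctness is required because cycles are simple by definition.\<close>

lemma walk_shorten:
  assumes "is_walk E xs"
  shows "\<exists>ys. is_walk E ys \<and> distinct ys \<and> hd ys = hd xs \<and> last ys = last xs"
  using assms
proof (induction "length xs" arbitrary: xs rule: less_induct)
  case less
  show ?case
  proof (cases "distinct xs")
    case False
    then obtain as bs cs z where xs: "xs = as @ [z] @ bs @ [z] @ cs"
      using not_distinct_decomp by blast
    let ?ys = "as @ [z] @ cs"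
    have "is_walk E ?ys" using less.prems unfolding xs is_walk_def
      by (auto simp: successively_append_iff successively_Cons)
    moreover have "length ?ys < length xs" by (simp add: xs)
    moreover have "hd ?ys = hd xs" "last ?ys = last xs" by (auto simp: xs hd_append)
    ultimately show ?thesis using less.hyps[of ?ys] by metis
  qed (use less.prems in blast)
qed

lemma is_walk_mono: "is_walk E xs \<Longrightarrow> E \<subseteq> E' \<Longrightarrow> is_walk E' xs"
  unfolding is_walk_def by (auto elim: successively_mono)

lemma tree_edge_bridge:
  assumes "finite_tree V E" "{x, y} \<in> E"
  shows "walks (E - {{x, y}}) x y = {}"
proof (rule ccontr)
  assume "walks (E - {{x, y}}) x y \<noteq> {}"
  then obtain zs where "is_walk (E - {{x, y}}) zs" "hd zs = x" "last zs = y"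
    by (auto simp: walks_def)
  then obtain xs where xs: "is_walk (E - {{x, y}}) xs" "distinct xs" "hd xs = x" "last xs = y"
    using walk_shorten by metis
  have "x \<noteq> y" using edge_endpoints(3) assms unfolding finite_tree_def by metis
  obtain xs' where xs': "xs = x # xs'" using xs(1,3) by (cases xs) (auto simp: is_walk_def)
  have "xs' \<noteq> []" using xs(4) \<open>x \<noteq> y\<close> xs' by auto
  then obtain b xs'' where b: "xs' = b # xs''" by (cases xs') auto
  \<comment> \<open>A walk with only two vertices would use the removed edge itself; this gives the
    third vertex that a cycle needs.\<close>
  have "xs'' \<noteq> []" using xs(1,4) unfolding xs' b by (auto simp: is_walk_def)
  then have "3 \<le> length xs" unfolding xs' b by (cases xs'') auto
  moreover have "is_walk E xs" using xs(1) by (rule is_walk_mono) auto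
  ultimately have "is_cycle E xs" using xs assms(2) by (auto simp: is_cycle_def insert_commute)
  then show False using assms(1) by (auto simp: finite_tree_def)
qed

lemma walk_length_ge_edge:
  assumes "\<forall>e\<in>E. 0 \<le> w e" "is_walk E xs" "\<not> is_walk (E - {e}) xs"
  shows "w e \<le> walk_length w xs"
  using assms(2,3)
proof (induction xs)
  case (Cons a xs)
  show ?case
  proof (cases "xs = []")
    case False
    then have *: "{a, hd xs} \<in> E" "is_walk E xs" using Cons.prems by (auto simp: is_walk_Cons)
    show ?thesis
    proof (cases "{a, hd xs} = e")
      case True
      then show ?thesis using walk_length_nonneg[OF assms(1) *(2)] False
        by (simp add: walk_length_Cons)
    next
      case ne: False
      then have "\<not> is_walk (E - {e}) xs" using Cons.prems(2) * False by (auto simp: is_walk_Cons)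
      then have "w e \<le> walk_length w xs" using Cons.IH * by simp
      then show ?thesis using assms(1)[rule_format, OF *(1)] False by (simp add: walk_length_Cons)
    qed
  qed (use Cons.prems in \<open>auto simp: is_walk_def\<close>)
qed (simp add: is_walk_def)

lemma path_dist_le:
  assumes "\<forall>e\<in>E. 0 \<le> w e" "is_walk E xs" "hd xs = x" "last xs = y"
  shows "path_dist E w x y \<le> walk_length w xs"
  unfolding path_dist_def
proof (rule cINF_lower)
  show "bdd_below (walk_length w ` walks E x y)"
    using walk_length_nonneg[OF assms(1)] by (auto simp: walks_def intro!: bdd_belowI[of _ 0])
qed (use assms in \<open>auto simp: walks_def\<close>)

lemma path_dist_refl:
  assumes "\<forall>e\<in>E. 0 \<le> w e"
  shows "path_dist E w x x = 0"
proof (rule antisym)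
  have *: "is_walk E [x]" by (simp add: is_walk_def)
  then show "path_dist E w x x \<le> 0" using path_dist_le[OF assms *] by simp
  show "0 \<le> path_dist E w x x" unfolding path_dist_def
    by (rule cINF_greatest) (use * walk_length_nonneg[OF assms] in \<open>force simp: walks_def\<close>)+
qed

text \<open>Acyclicity enters here: every walk between the endpoints has to cross the bridge, so no
  detour can be shorter than the edge.\<close>

lemma path_dist_edge:
  assumes "finite_tree V E" "\<forall>e\<in>E. 0 \<le> w e" "{x, y} \<in> E"
  shows "path_dist E w x y = w {x, y}"
proof (rule antisym)
  have *: "is_walk E [x, y]" using assms(3) by (simp add: is_walk_def)
  then show "path_dist E w x y \<le> w {x, y}"
    using path_dist_le[OF assms(2) *] by (simp add: walk_length_Cons)
  show "w {x, y} \<le> path_dist E w x y" unfolding path_dist_def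
  proof (rule cINF_greatest)
    show "walks E x y \<noteq> {}" using * by (force simp: walks_def)
  next
    fix xs assume "xs \<in> walks E x y"
    then have "is_walk E xs" "\<not> is_walk (E - {{x, y}}) xs"
      using tree_edge_bridge[OF assms(1,3)] by (auto simp: walks_def)
    then show "w {x, y} \<le> walk_length w xs" using walk_length_ge_edge[OF assms(2)] by metis
  qed
qed

lemma path_dist_step:
  assumes "\<forall>e\<in>E. 0 \<le> w e" "walks E x a \<noteq> {}" "{a, b} \<in> E"
  shows "path_dist E w x b \<le> path_dist E w x a + w {a, b}"
proof -
  have "path_dist E w x b - w {a, b} \<le> path_dist E w x a"
    unfolding path_dist_def[of E w x a]
  proof (rule cINF_greatest[OF assms(2)])
    fix xs assume "xs \<in> walks E x a"
    then have xs: "is_walk E xs" "hd xs = x" "last xs = a" "xs \<noteq> []"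
      by (auto simp: walks_def is_walk_def)
    then have "is_walk E (xs @ [b])" using is_walk_append_edge assms(3) by metis
    then have "path_dist E w x b \<le> walk_length w (xs @ [b])"
      using xs by (intro path_dist_le[OF assms(1)]) auto
    then show "path_dist E w x b - w {a, b} \<le> walk_length w xs"
      using xs by (simp add: walk_length_snoc)
  qed
  then show ?thesis by simp
qed

section \<open>Lazy measures and sums over neighbours\<close>

lemma bij_betw_incident:
  assumes "finite_graph V E"
  shows "bij_betw (\<lambda>z. {x, z}) {z \<in> V. {x, z} \<in> E} (incident E x)"
  unfolding bij_betw_def
proof
  show "inj_on (\<lambda>z. {x, z}) {z \<in> V. {x, z} \<in> E}" by (auto simp: inj_on_def doubleton_eq_iff)
  show "(\<lambda>z. {x, z}) ` {z \<in> V. {x, z} \<in> E} = incident E x"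
  proof
    show "incident E x \<subseteq> (\<lambda>z. {x, z}) ` {z \<in> V. {x, z} \<in> E}"
    proof
      fix e assume "e \<in> incident E x"
      then have "e \<in> E" "x \<in> e" by (auto simp: incident_def)
      moreover from this obtain a b where "a \<in> V" "b \<in> V" "e = {a, b}"
        using assms unfolding finite_graph_def by blast
      ultimately show "e \<in> (\<lambda>z. {x, z}) ` {z \<in> V. {x, z} \<in> E}"
        by (auto simp: insert_commute)
    qed
  qed (auto simp: incident_def)
qed

lemma sum_neighbours:
  assumes "finite_graph V E"
  shows "(\<Sum>z\<in>{z \<in> V. {x, z} \<in> E}. h {x, z}) = (\<Sum>e\<in>incident E x. h e)"
  using sum.reindex_bij_betw[OF bij_betw_incident[OF assms]] .

lemma finite_graph_finite_edges: "finite_graph V E \<Longrightarrow> finite E"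
  by (rule finite_subset[of _ "Pow V"]) (auto simp: finite_graph_def)

text \<open>Used with \<open>h = 1\<close> for the total mass and with \<open>h\<close> the
  Kantorovich potential for the dual value of the transport problem.\<close>

lemma lazy_measure_sum:
  assumes G: "finite_graph V E" and "x \<in> V"
  shows "(\<Sum>z\<in>V. h z * lazy_measure E w \<alpha> x z) =
    \<alpha> * h x + (1 - \<alpha>) * (\<Sum>z\<in>{z \<in> V. {x, z} \<in> E}. h z * (1 / w {x, z})) / inv_weight_sum E w x"
proof -
  have fin: "finite V" using G by (simp add: finite_graph_def)
  let ?N = "{z \<in> V. {x, z} \<in> E}"
  have x: "x \<notin> ?N" using edge_endpoints(3)[OF G] by blast
  have "(\<Sum>z\<in>V. h z * lazy_measure E w \<alpha> x z) = (\<Sum>z\<in>insert x ?N. h z * lazy_measure E w \<alpha> x z)"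
    by (rule sum.mono_neutral_right) (use fin assms(2) in \<open>auto simp: lazy_measure_def\<close>)
  also have "\<dots> = \<alpha> * h x + (\<Sum>z\<in>?N. h z * lazy_measure E w \<alpha> x z)"
    using fin x by (subst sum.insert) (auto simp: lazy_measure_def)
  also have "(\<Sum>z\<in>?N. h z * lazy_measure E w \<alpha> x z)
      = (\<Sum>z\<in>?N. (1 - \<alpha>) / inv_weight_sum E w x * (h z * (1 / w {x, z})))"
    by (rule sum.cong) (use x in \<open>auto simp: lazy_measure_def ac_simps\<close>)
  also have "\<dots> = (1 - \<alpha>) / inv_weight_sum E w x * (\<Sum>z\<in>?N. h z * (1 / w {x, z}))"
    by (simp only: sum_distrib_left)
  finally show ?thesis by (simp add: mult.commute)
qed

lemma inv_weight_sum_pos: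
  assumes "finite E" "\<forall>e\<in>E. 0 < w e" "incident E x \<noteq> {}"
  shows "0 < inv_weight_sum E w x"
  unfolding inv_weight_sum_def using assms by (intro sum_pos) (auto simp: incident_def)

lemma lazy_measure_total:
  assumes G: "finite_graph V E" and "{x, y} \<in> E" and pos: "\<forall>e\<in>E. 0 < w e"
  shows "(\<Sum>z\<in>V. lazy_measure E w \<alpha> x z) = 1"
proof -
  have "x \<in> V" using edge_endpoints[OF assms(1,2)] by auto
  have "(\<Sum>z\<in>{z \<in> V. {x, z} \<in> E}. 1 / w {x, z}) = inv_weight_sum E w x"
    using sum_neighbours[OF G] by (simp add: inv_weight_sum_def)
  moreover have "inv_weight_sum E w x > 0"
    by (rule inv_weight_sum_pos) (use assms finite_graph_finite_edges in \<open>auto simp: incident_def\<close>)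
  ultimately show ?thesis using lazy_measure_sum[OF G \<open>x \<in> V\<close>, of "\<lambda>_. 1" w \<alpha>] by simp
qed

section \<open>Kantorovich duality for the endpoints of an edge\<close>

lemma edge_potential:
  assumes tree: "finite_tree V E" and xy: "{x, y} \<in> E" and pos: "\<forall>e\<in>E. 0 \<le> w e"
  obtains f :: "'a \<Rightarrow> real" where
    "\<And>a b. {a, b} \<in> E \<Longrightarrow> f a - f b \<le> w {a, b}" "f x = w {x, y}" "f y = 0"
    "\<And>z. {x, z} \<in> E \<Longrightarrow> z \<noteq> y \<Longrightarrow> f z = w {x, y} + w {x, z}"
    "\<And>z. {y, z} \<in> E \<Longrightarrow> z \<noteq> x \<Longrightarrow> f z = - w {y, z}"
proof -
  have G: "finite_graph V E" and conn: "\<And>a b. a \<in> V \<Longrightarrow> b \<in> V \<Longrightarrow> walks E a b \<noteq> {}"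
    using tree by (auto simp: finite_tree_def)
  let ?E' = "E - {{x, y}}"
  \<comment> \<open>\<open>A\<close> is the component of \<open>x\<close> after removal of the edge.
    Every other edge has both ends on one side, where \<open>f\<close> is a signed distance up to a
    constant and the triangle inequality applies.\<close>
  define A where "A = {a. walks ?E' x a \<noteq> {}}"
  define f where "f a = (if a \<in> A then w {x, y} + path_dist E w x a else - path_dist E w y a)" for a
  note V = edge_endpoints[OF G]
  have "x \<in> A" unfolding A_def walks_def by (auto intro!: exI[of _ "[x]"] simp: is_walk_def)
  have "y \<notin> A" using tree_edge_bridge[OF tree xy] by (simp add: A_def)
  have step: "b \<in> A" if "a \<in> A" "{a, b} \<in> ?E'" for a b
  proof -
    from \<open>a \<in> A\<close> obtain xs where "is_walk ?E' xs" "hd xs = x" "last xs = a"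
      by (auto simp: A_def walks_def)
    then have "is_walk ?E' (xs @ [b])" "hd (xs @ [b]) = x" "last (xs @ [b]) = b"
      using is_walk_append_edge[of ?E' xs b] that by (auto simp: is_walk_def hd_append)
    then show ?thesis unfolding A_def walks_def by blast
  qed
  have nbx: "z \<in> A" if "{x, z} \<in> E" "z \<noteq> y" for z
    using step[OF \<open>x \<in> A\<close>, of z] that by (auto simp: doubleton_eq_iff)
  have nby: "z \<notin> A" if "{y, z} \<in> E" "z \<noteq> x" for z
    using step[of z y] \<open>y \<notin> A\<close> that by (auto simp: doubleton_eq_iff insert_commute)
  have fx: "f x = w {x, y}" using \<open>x \<in> A\<close> path_dist_refl[OF pos, of x] by (simp add: f_def)
  have fy: "f y = 0" using \<open>y \<notin> A\<close> path_dist_refl[OF pos, of y] by (simp add: f_def)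
  have lip: "f a - f b \<le> w {a, b}" if ab: "{a, b} \<in> E" for a b
  proof (cases "{a, b} = {x, y}")
    case True
    then show ?thesis using fx fy pos[rule_format, OF xy] by (auto simp: doubleton_eq_iff insert_commute)
  next
    case False
    then have same: "a \<in> A \<longleftrightarrow> b \<in> A" using ab step[of a b] step[of b a] by (auto simp: insert_commute)
    have "walks E u v \<noteq> {}" if "u \<in> {x, y}" "v \<in> {a, b}" for u v
      using conn V[OF ab] V[OF xy] that by auto
    then have step: "path_dist E w u b \<le> path_dist E w u a + w {a, b}"
      "path_dist E w u a \<le> path_dist E w u b + w {a, b}" if "u \<in> {x, y}" for u
      using path_dist_step[OF pos, of u a b] path_dist_step[OF pos, of u b a] ab that
      by (auto simp: insert_commute)
    show ?thesis using same step[of x] step[of y] by (auto simp: f_def)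
  qed
  show ?thesis
  proof (rule that[of f])
    show "f z = w {x, y} + w {x, z}" if "{x, z} \<in> E" "z \<noteq> y" for z
      using nbx[OF that] path_dist_edge[OF tree pos that(1)] by (simp add: f_def)
    show "f z = - w {y, z}" if "{y, z} \<in> E" "z \<noteq> x" for z
      using nby[OF that] path_dist_edge[OF tree pos that(1)] by (simp add: f_def)
  qed (use lip fx fy in auto)
qed

text \<open>The cost of a difference of potentials sees only the marginals, so it is a lower bound
  common to all couplings.\<close>

lemma coupling_potential_cost:
  assumes "finite V" "\<pi> \<in> couplings V \<mu> \<nu>"
  shows "(\<Sum>a\<in>V. \<Sum>b\<in>V. (f a - f b) * \<pi> a b) = (\<Sum>a\<in>V. f a * \<mu> a) - (\<Sum>b\<in>V. f b * \<nu> b)"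
proof -
  have "(\<Sum>a\<in>V. \<Sum>b\<in>V. (f a - f b) * \<pi> a b) =
      (\<Sum>a\<in>V. \<Sum>b\<in>V. f a * \<pi> a b) - (\<Sum>a\<in>V. \<Sum>b\<in>V. f b * \<pi> a b)"
    by (simp add: left_diff_distrib sum_subtractf)
  also have "(\<Sum>a\<in>V. \<Sum>b\<in>V. f a * \<pi> a b) = (\<Sum>a\<in>V. f a * \<mu> a)"
    using assms(2) by (auto simp: couplings_def sum_distrib_left[symmetric] intro!: sum.cong)
  also have "(\<Sum>a\<in>V. \<Sum>b\<in>V. f b * \<pi> a b) = (\<Sum>b\<in>V. f b * \<nu> b)"
    using assms(2)
    by (subst sum.swap) (auto simp: couplings_def sum_distrib_left[symmetric] intro!: sum.cong)
  finally show ?thesis .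
qed

text \<open>Complementary slackness: a coupling that charges only pairs where the Lipschitz bound is
  an equality attains the dual value.\<close>

lemma wasserstein1_eqI:
  fixes f :: "'a \<Rightarrow> real"
  assumes fin: "finite V" and lip: "\<And>a b. a \<in> V \<Longrightarrow> b \<in> V \<Longrightarrow> f a - f b \<le> d a b"
    and \<pi>: "\<pi> \<in> couplings V \<mu> \<nu>"
    and tight: "\<And>a b. a \<in> V \<Longrightarrow> b \<in> V \<Longrightarrow> \<pi> a b \<noteq> 0 \<Longrightarrow> d a b \<le> f a - f b"
  shows "wasserstein1 V d \<mu> \<nu> = (\<Sum>a\<in>V. f a * \<mu> a) - (\<Sum>b\<in>V. f b * \<nu> b)"
proof -
  let ?cost = "\<lambda>\<pi>. \<Sum>a\<in>V. \<Sum>b\<in>V. d a b * \<pi> a b"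
  let ?W = "(\<Sum>a\<in>V. f a * \<mu> a) - (\<Sum>b\<in>V. f b * \<nu> b)"
  have lower: "?W \<le> ?cost \<pi>'" if "\<pi>' \<in> couplings V \<mu> \<nu>" for \<pi>'
    unfolding coupling_potential_cost[OF fin that, symmetric]
    using that lip by (intro sum_mono mult_right_mono) (auto simp: couplings_def)
  have upper: "?cost \<pi> \<le> ?W"
    unfolding coupling_potential_cost[OF fin \<pi>, symmetric]
  proof (intro sum_mono)
    fix a b assume "a \<in> V" "b \<in> V"
    then show "d a b * \<pi> a b \<le> (f a - f b) * \<pi> a b"
      using tight[of a b] \<pi> by (cases "\<pi> a b = 0") (auto simp: couplings_def intro!: mult_right_mono)
  qed
  show ?thesis unfolding wasserstein1_def
  proof (rule antisym)
    have "bdd_below (?cost ` couplings V \<mu> \<nu>)" using lower by (auto intro!: bdd_belowI[of _ ?W])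
    then show "(INF \<pi>\<in>couplings V \<mu> \<nu>. ?cost \<pi>) \<le> ?W" using \<pi> upper by (auto intro: cINF_lower2)
    show "?W \<le> (INF \<pi>\<in>couplings V \<mu> \<nu>. ?cost \<pi>)" using lower \<pi> by (auto intro!: cINF_greatest)
  qed
qed

text \<open>Every atom of the first measure away from \<open>x\<close> is sent to \<open>y\<close>, and every atom of the second one
  away from \<open>y\<close> is supplied from \<open>x\<close>; for \<open>\<alpha> \<ge> 1/2\<close> the atom at \<open>x\<close> is large enough for this.\<close>

lemma lazy_coupling:
  assumes G: "finite_graph V E" and xy: "{x, y} \<in> E" and pos: "\<forall>e\<in>E. 0 < w e"
    and \<alpha>: "1 / 2 \<le> \<alpha>" "\<alpha> \<le> 1"
  shows "(\<lambda>a b. if a = x \<and> b = y then 2 * \<alpha> - 1 else if b = y then lazy_measure E w \<alpha> x a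
           else if a = x then lazy_measure E w \<alpha> y b else 0)
    \<in> couplings V (lazy_measure E w \<alpha> x) (lazy_measure E w \<alpha> y)" (is "?\<pi> \<in> _")
proof -
  have fin: "finite V" using G by (simp add: finite_graph_def)
  note V = edge_endpoints[OF G xy]
  \<comment> \<open>Each measure has mass \<open>1 - \<alpha>\<close> away from its centre. Of the
    atom \<alpha> at \<open>x\<close> this much is spent on supplying the second measure away from
    \<open>y\<close>, which leaves \<open>2 * \<alpha> - 1\<close> for the pair
    \<open>(x, y)\<close>.\<close>
  have mass: "(\<Sum>z\<in>V - {u}. lazy_measure E w \<alpha> u z) = 1 - \<alpha>" if "{u, v} \<in> E" for u v
    using lazy_measure_total[OF G that pos] sum.remove[OF fin, of u "lazy_measure E w \<alpha> u"]
      edge_endpoints[OF G that] by (simp add: lazy_measure_def)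
  have nonneg: "0 \<le> lazy_measure E w \<alpha> u z" for u z
  proof -
    have "0 \<le> inv_weight_sum E w u" unfolding inv_weight_sum_def
      using pos by (intro sum_nonneg) (auto simp: incident_def less_imp_le)
    then show ?thesis using pos[rule_format, of "{u, z}"] \<alpha> by (auto simp: lazy_measure_def)
  qed
  have row: "(\<Sum>b\<in>V. ?\<pi> a b) = lazy_measure E w \<alpha> x a" if "a \<in> V" for a
  proof -
    have "(\<Sum>b\<in>V. ?\<pi> a b) = ?\<pi> a y + (\<Sum>b\<in>V - {y}. if a = x then lazy_measure E w \<alpha> y b else 0)"
      by (subst sum.remove[OF fin \<open>y \<in> V\<close>]) (auto intro!: sum.cong)
    also have "\<dots> = lazy_measure E w \<alpha> x a"
    proof (cases "a = x")
      case True
      then show ?thesis using mass[of y x] xy by (simp add: insert_commute lazy_measure_def)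
    qed simp
    finally show ?thesis .
  qed
  have col: "(\<Sum>a\<in>V. ?\<pi> a b) = lazy_measure E w \<alpha> y b" if "b \<in> V" for b
  proof -
    have "(\<Sum>a\<in>V. ?\<pi> a b) = ?\<pi> x b + (\<Sum>a\<in>V - {x}. if b = y then lazy_measure E w \<alpha> x a else 0)"
      by (subst sum.remove[OF fin \<open>x \<in> V\<close>]) (auto intro!: sum.cong split: if_splits)
    also have "\<dots> = lazy_measure E w \<alpha> y b"
    proof (cases "b = y")
      case True
      then show ?thesis using mass[OF xy] by (simp add: lazy_measure_def)
    qed simp
    finally show ?thesis .
  qed
  have "0 \<le> ?\<pi> a b" for a b using nonneg \<alpha> by auto
  then show ?thesis using row col unfolding couplings_def by blast
qed

lemma wasserstein1_lazy:
  assumes tree: "finite_tree V E" and xy: "{x, y} \<in> E" and pos: "\<forall>e\<in>E. 0 < w e"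
    and \<alpha>: "1 / 2 \<le> \<alpha>" "\<alpha> \<le> 1"
  shows "wasserstein1 V (path_dist E w) (lazy_measure E w \<alpha> x) (lazy_measure E w \<alpha> y) =
    w {x, y} + (1 - \<alpha>) * ((real (degree E x) - 2) / inv_weight_sum E w x
      + (real (degree E y) - 2) / inv_weight_sum E w y)"
proof -
  have pos': "\<forall>e\<in>E. 0 \<le> w e" using pos by (simp add: less_imp_le)
  have G: "finite_graph V E" and conn: "\<And>a b. a \<in> V \<Longrightarrow> b \<in> V \<Longrightarrow> walks E a b \<noteq> {}"
    using tree by (auto simp: finite_tree_def)
  have fin: "finite V" using G by (simp add: finite_graph_def)
  have finE: "finite E" by (rule finite_graph_finite_edges[OF G])
  note V = edge_endpoints[OF G xy]
  obtain f :: "'a \<Rightarrow> real" where f: "\<And>a b. {a, b} \<in> E \<Longrightarrow> f a - f b \<le> w {a, b}" "f x = w {x, y}" "f y = 0"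
    "\<And>z. {x, z} \<in> E \<Longrightarrow> z \<noteq> y \<Longrightarrow> f z = w {x, y} + w {x, z}"
    "\<And>z. {y, z} \<in> E \<Longrightarrow> z \<noteq> x \<Longrightarrow> f z = - w {y, z}"
    using edge_potential[OF tree xy pos'] by metis
  let ?\<mu> = "lazy_measure E w \<alpha> x" and ?\<nu> = "lazy_measure E w \<alpha> y"
  let ?\<pi> = "\<lambda>a b. if a = x \<and> b = y then 2 * \<alpha> - 1 else if b = y then ?\<mu> a
           else if a = x then ?\<nu> b else 0"
  have W: "wasserstein1 V (path_dist E w) ?\<mu> ?\<nu> = (\<Sum>a\<in>V. f a * ?\<mu> a) - (\<Sum>b\<in>V. f b * ?\<nu> b)"
  proof (rule wasserstein1_eqI[OF fin _ lazy_coupling[OF G xy pos \<alpha>]])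
    fix a b assume "a \<in> V" "b \<in> V"
    then show "f a - f b \<le> path_dist E w a b" unfolding path_dist_def
      using conn walk_potential_bound[of E f w, OF f(1)]
      by (intro cINF_greatest) (auto simp: walks_def)
  next
    fix a b assume ab: "?\<pi> a b \<noteq> 0"
    have len: "path_dist E w u v \<le> walk_length w xs" if "is_walk E xs" "hd xs = u" "last xs = v" for u v xs
      using path_dist_le[OF pos' that] .
    \<comment> \<open>The pairs that can carry mass: along the edge, from a neighbour of
      \<open>x\<close> to \<open>y\<close>, and from \<open>x\<close> to a neighbour of
      \<open>y\<close>. The subcases \<open>a = y\<close> and \<open>b = x\<close> are mass that
      stays in place.\<close>
    consider "a = x" "b = y" | "a \<noteq> x" "b = y" "{x, a} \<in> E" | "a = x" "b \<noteq> y" "{y, b} \<in> E"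
      using ab by (auto simp: lazy_measure_def split: if_splits)
    then show "path_dist E w a b \<le> f a - f b"
    proof cases
      case 1
      then show ?thesis using path_dist_edge[OF tree pos' xy] f by simp
    next
      case 2
      show ?thesis
      proof (cases "a = y")
        case True
        then show ?thesis using 2 path_dist_refl[OF pos'] by simp
      next
        case False
        then show ?thesis using 2 f(3,4) xy len[of "[a, x, y]" a y]
          by (simp add: is_walk_def walk_length_Cons insert_commute)
      qed
    next
      case 3
      show ?thesis
      proof (cases "b = x")
        case True
        then show ?thesis using 3 path_dist_refl[OF pos'] by simp
      next
        case False
        then show ?thesis using 3 f(2,5) xy len[of "[x, y, b]" x b]
          by (simp add: is_walk_def walk_length_Cons insert_commute)
      qed
    qed
  qed
  have D: "inv_weight_sum E w x > 0" "inv_weight_sum E w y > 0"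
    using inv_weight_sum_pos[OF finE pos] xy by (auto simp: incident_def)
  let ?N = "\<lambda>u. {z \<in> V. {u, z} \<in> E}"
  have finN: "finite (?N u)" for u using fin by simp
  have cardN: "card (?N u) = degree E u" for u
    using bij_betw_same_card[OF bij_betw_incident[OF G]] by (simp add: degree_def)
  have nz: "w e \<noteq> 0" if "e \<in> E" for e using pos[rule_format, OF that] by simp
  \<comment> \<open>A neighbour \<open>z\<close> other than \<open>y\<close> contributes
    \<open>w {x, y} / w {x, z} + 1\<close>. For \<open>z = y\<close> the value
    \<open>f y = 0\<close> gives \<open>0 = 1 + 1 - 2\<close>, and this correction is the origin of
    the 2 in \<open>degree E x - 2\<close>.\<close>
  have sx: "(\<Sum>z\<in>?N x. f z * (1 / w {x, z})) = w {x, y} * inv_weight_sum E w x + (real (degree E x) - 2)"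
  proof -
    have "(\<Sum>z\<in>?N x. f z * (1 / w {x, z})) =
        (\<Sum>z\<in>?N x. w {x, y} * (1 / w {x, z}) + 1 - (if z = y then 2 else 0))"
    proof (rule sum.cong[OF refl])
      fix z assume "z \<in> ?N x"
      then show "f z * (1 / w {x, z}) = w {x, y} * (1 / w {x, z}) + 1 - (if z = y then 2 else 0)"
        using f nz[of "{x, z}"] by (cases "z = y") (auto simp: field_simps)
    qed
    also have "\<dots> = w {x, y} * (\<Sum>z\<in>?N x. 1 / w {x, z}) + real (card (?N x)) - 2"
      using xy V finN by (simp add: sum_subtractf sum.distrib sum_distrib_left sum.delta)
    finally show ?thesis using sum_neighbours[OF G, of "\<lambda>e. 1 / w e"] cardN
      by (simp add: inv_weight_sum_def)
  qed
  have sy: "(\<Sum>z\<in>?N y. f z * (1 / w {y, z})) = 2 - real (degree E y)"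
  proof -
    have "(\<Sum>z\<in>?N y. f z * (1 / w {y, z})) = (\<Sum>z\<in>?N y. - 1 + (if z = x then 2 else 0))"
    proof (rule sum.cong[OF refl])
      fix z assume "z \<in> ?N y"
      then show "f z * (1 / w {y, z}) = - 1 + (if z = x then 2 else 0)"
        using f nz[of "{y, z}"] by (cases "z = x") (auto simp: field_simps insert_commute)
    qed
    also have "\<dots> = 2 - real (card (?N y))"
      using xy V finN by (simp only: sum.distrib sum.delta) (simp add: insert_commute)
    finally show ?thesis using cardN by simp
  qed
  have "(\<Sum>a\<in>V. f a * ?\<mu> a) = w {x, y} + (1 - \<alpha>) * ((real (degree E x) - 2) / inv_weight_sum E w x)"
    unfolding lazy_measure_sum[OF G V(1)] sx f(2) using D by (simp add: field_simps)
  moreover have "(\<Sum>a\<in>V. f a * ?\<nu> a) = (1 - \<alpha>) * ((2 - real (degree E y)) / inv_weight_sum E w y)"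
    unfolding lazy_measure_sum[OF G V(2)] sy f(3) by simp
  moreover have "(2 - real (degree E y)) / inv_weight_sum E w y = - ((real (degree E y) - 2) / inv_weight_sum E w y)"
    by (simp only: minus_divide_left minus_diff_eq)
  ultimately show ?thesis unfolding W by (simp only: distrib_left)
qed

text \<open>The transport cost is affine in \<alpha> on \<open>[1/2, 1]\<close>, so the difference
  quotient is constant near 1 and the limit is its value.\<close>

lemma lly_curvature_tree:
  assumes tree: "finite_tree V E" and xy: "{x, y} \<in> E" and pos: "\<forall>e\<in>E. 0 < w e"
  shows "lly_curvature V E w x y =
    (2 - real (degree E x)) / (w {x, y} * inv_weight_sum E w x) +
    (2 - real (degree E y)) / (w {x, y} * inv_weight_sum E w y)" (is "_ = ?k")
  unfolding lly_curvature_def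
proof (rule tendsto_Lim)
  have G: "finite_graph V E" using tree by (simp add: finite_tree_def)
  have D: "inv_weight_sum E w x > 0" "inv_weight_sum E w y > 0"
    using inv_weight_sum_pos[OF finite_graph_finite_edges[OF G] pos] xy by (auto simp: incident_def)
  have "\<forall>\<^sub>F \<alpha> in at_left (1::real). \<alpha> \<in> {1/2<..<1}"
    by (rule eventually_at_leftI[of "1/2"]) auto
  then have "\<forall>\<^sub>F \<alpha> in at_left 1. ?k =
      (1 - wasserstein1 V (path_dist E w) (lazy_measure E w \<alpha> x) (lazy_measure E w \<alpha> y) / w {x, y})
       / (1 - \<alpha>)"
  proof (rule eventually_mono)
    fix \<alpha> :: real assume "\<alpha> \<in> {1/2<..<1}"
    then have \<alpha>: "1/2 \<le> \<alpha>" "\<alpha> \<le> 1" "1 - \<alpha> \<noteq> 0" by auto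
    show "?k = (1 - wasserstein1 V (path_dist E w) (lazy_measure E w \<alpha> x) (lazy_measure E w \<alpha> y) / w {x, y})
       / (1 - \<alpha>)"
      unfolding wasserstein1_lazy[OF tree xy pos \<alpha>(1,2)] using D pos[rule_format, OF xy] \<alpha>(3)
      by (simp add: field_simps)
  qed
  then show "((\<lambda>\<alpha>. (1 - wasserstein1 V (path_dist E w) (lazy_measure E w \<alpha> x) (lazy_measure E w \<alpha> y) / w {x, y})
       / (1 - \<alpha>)) \<longlongrightarrow> ?k) (at_left 1)"
    by (rule tendsto_eventually[OF eventually_mono]) simp
qed simp

text \<open>The formula is symmetric in the two endpoints, which makes the definite description in
  \<open>curv\<close> meaningful. Writing it as the face curvature with \<open>C = E\<close> lets
  the tree and its faces share one theory.\<close>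

lemma curv_tree:
  assumes tree: "finite_tree V E" and "e \<in> E" and pos: "\<forall>e\<in>E. 0 < w e"
  shows "curv V E w e = face_curv E E w e"
proof -
  have G: "finite_graph V E" using tree by (simp add: finite_tree_def)
  obtain x y where e: "e = {x, y}" "x \<noteq> y"
    using G \<open>e \<in> E\<close> unfolding finite_graph_def by blast
  have *: "lly_curvature V E w a b = face_curv E E w e" if "e = {a, b}" for a b
  proof -
    have "{v. v \<in> e \<and> incident E v \<subseteq> E} = {a, b}" "a \<noteq> b"
      using that e by (auto simp: incident_def doubleton_eq_iff)
    then show ?thesis using lly_curvature_tree[OF tree _ pos, of a b] \<open>e \<in> E\<close> that
      by (simp add: face_curv_def inv_weight_sum_def)
  qed
  show ?thesis unfolding curv_def using * e(1) by (intro the_equality) metis+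
qed

section \<open>Gradient flows of convex functions\<close>

lemma has_real_derivative_within_ray:
  fixes f :: "real \<Rightarrow> real"
  assumes "(f has_real_derivative D) (at t within {0..})" "0 < t"
  shows "(f has_real_derivative D) (at t)"
proof -
  have "at t within {0..} = at t" using assms(2) by (intro at_within_nhd[of t "{0<..}"]) auto
  then show ?thesis using assms(1) by simp
qed

lemma mvt_ray:
  fixes f :: "real \<Rightarrow> real"
  assumes "\<And>t. 0 \<le> t \<Longrightarrow> (f has_real_derivative f' t) (at t within {0..})" "0 \<le> s" "s < t"
  obtains r where "s < r" "r < t" "f t - f s = (t - s) * f' r"
proof -
  have "continuous_on {s..t} f"
    using assms(2) by (intro DERIV_continuous_on[of _ _ f'] DERIV_subset[OF assms(1)]) auto
  moreover have "(f has_real_derivative f' r) (at r)" if "s < r" for r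
    using has_real_derivative_within_ray[OF assms(1)] that assms(2) by auto
  ultimately have "\<exists>r. s < r \<and> r < t \<and> f t - f s = (t - s) * f' r"
    using MVT[OF assms(3), of f] assms(2)
    by (smt (verit) DERIV_unique real_differentiable_def)
  then show ?thesis using that by blast
qed

lemma nonincreasing_ray:
  fixes f :: "real \<Rightarrow> real"
  assumes "\<And>t. 0 \<le> t \<Longrightarrow> (f has_real_derivative f' t) (at t within {0..})"
    and "\<And>t. T \<le> t \<Longrightarrow> f' t \<le> 0" "0 \<le> T" "T \<le> s" "s \<le> t"
  shows "f t \<le> f s"
proof (cases "s = t")
  case False
  then have "0 \<le> s" "s < t" using assms(3-5) by auto
  then obtain r where "s < r" "f t - f s = (t - s) * f' r"
    using mvt_ray[OF assms(1)] by metis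
  moreover have "(t - s) * f' r \<le> 0"
    using assms \<open>s < r\<close> by (intro mult_nonneg_nonpos) auto
  ultimately show ?thesis by simp
qed simp

lemma tendsto_zero_dominated:
  fixes f g :: "'b \<Rightarrow> real"
  assumes "\<forall>\<^sub>F x in F. \<bar>f x\<bar> \<le> g x" "(g \<longlongrightarrow> 0) F"
  shows "(f \<longlongrightarrow> 0) F"
  by (rule tendsto_0_le[OF assms(2), of _ 1]) (use assms(1) in \<open>auto elim: eventually_mono\<close>)

lemma antimono_bounded_tail:
  fixes N :: "real \<Rightarrow> real"
  assumes "\<And>s t. 0 \<le> s \<Longrightarrow> s \<le> t \<Longrightarrow> N t \<le> N s" "\<And>t. 0 \<le> N t"
  obtains L where "\<And>t. 0 \<le> t \<Longrightarrow> L \<le> N t" "\<And>\<epsilon>. 0 < \<epsilon> \<Longrightarrow> \<exists>S\<ge>0. \<forall>t\<ge>S. N t < L + \<epsilon>"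
proof -
  let ?L = "INF t\<in>{0..}. N t"
  have bdd: "bdd_below (N ` {0..})" using assms(2) by (auto intro!: bdd_belowI[of _ 0])
  have "?L \<le> N t" if "0 \<le> t" for t using bdd that by (auto intro: cINF_lower)
  moreover have "\<exists>S\<ge>0. \<forall>t\<ge>S. N t < ?L + \<epsilon>" if "0 < \<epsilon>" for \<epsilon>
  proof -
    have "?L < ?L + \<epsilon>" using that by simp
    then obtain S where "0 \<le> S" "N S < ?L + \<epsilon>"
      using cINF_less_iff[OF _ bdd, of "?L + \<epsilon>"] by auto
    then show ?thesis using assms(1) by (meson le_less_trans)
  qed
  ultimately show ?thesis using that by blast
qed

lemma real_cauchy_at_top_converges:
  fixes f :: "real \<Rightarrow> real"
  assumes "\<And>\<epsilon>. 0 < \<epsilon> \<Longrightarrow> \<exists>S. \<forall>s\<ge>S. \<forall>t\<ge>s. \<bar>f t - f s\<bar> < \<epsilon>"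
  shows "\<exists>l. (f \<longlongrightarrow> l) at_top"
proof -
  have "Cauchy (\<lambda>n. f (real n))"
  proof (rule metric_CauchyI)
    fix \<epsilon> :: real assume "0 < \<epsilon>"
    then obtain S where S: "\<forall>s\<ge>S. \<forall>t\<ge>s. \<bar>f t - f s\<bar> < \<epsilon>" using assms by blast
    obtain M where "S \<le> real M" using real_arch_simple by blast
    then have *: "dist (f (real m)) (f (real n)) < \<epsilon>" if "M \<le> m" "m \<le> n" for m n
      using S[rule_format, of "real m" "real n"] that by (simp add: dist_real_def abs_minus_commute)
    have "dist (f (real m)) (f (real n)) < \<epsilon>" if "M \<le> m" "M \<le> n" for m n
      using *[of m n] *[of n m] that by (cases m n rule: le_cases) (auto simp: dist_commute)
    then show "\<exists>M. \<forall>m\<ge>M. \<forall>n\<ge>M. dist (f (real m)) (f (real n)) < \<epsilon>" by blast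
  qed
  then obtain l where l: "(\<lambda>n. f (real n)) \<longlonglongrightarrow> l"
    using Cauchy_convergent convergent_def by blast
  have "(f \<longlongrightarrow> l) at_top"
  proof (rule tendstoI)
    fix \<epsilon> :: real assume "0 < \<epsilon>"
    then obtain S where S: "\<forall>s\<ge>S. \<forall>t\<ge>s. \<bar>f t - f s\<bar> < \<epsilon> / 2" using assms[of "\<epsilon> / 2"] by auto
    have "dist (f s) l < \<epsilon>" if "S \<le> s" for s
    proof -
      obtain M where M: "s \<le> real M" using real_arch_simple by blast
      have "(\<lambda>n. \<bar>f (real n) - f s\<bar>) \<longlonglongrightarrow> \<bar>l - f s\<bar>" by (intro tendsto_intros l)
      moreover have "\<bar>f (real n) - f s\<bar> \<le> \<epsilon> / 2" if "M \<le> n" for n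
        using S \<open>S \<le> s\<close> M that by (simp add: less_imp_le)
      ultimately have "\<bar>l - f s\<bar> \<le> \<epsilon> / 2" by (intro LIMSEQ_le_const2) auto
      then show ?thesis using \<open>0 < \<epsilon>\<close> by (simp add: dist_real_def abs_minus_commute)
    qed
    then show "\<forall>\<^sub>F s in at_top. dist (f s) l < \<epsilon>" by (auto simp: eventually_at_top_linorder)
  qed
  then show ?thesis by blast
qed

text \<open>The average \<open>a(s, t)\<close> of the gradient over \<open>[s, t]\<close> satisfies \<open>\<bar>a\<bar>\<^sup>2 \<le> N s\<close> and, by
  convexity, \<open>\<langle>g s, a\<rangle> \<ge> L\<close>, where \<open>N = \<bar>g\<bar>\<^sup>2\<close> decreases to \<open>L\<close>.  Hence it is close to \<open>g s\<close>.
  Since \<open>a(s, 2 s' - s)\<close> is the midpoint of \<open>a(s, s')\<close> and \<open>a(s', 2 s' - s)\<close>, this also makes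
  \<open>g s'\<close> close to \<open>g s\<close>.\<close>

lemma convex_gradient_flow_gradient_converges:
  fixes g :: "('i \<Rightarrow> real) \<Rightarrow> 'i \<Rightarrow> real" and v :: "real \<Rightarrow> 'i \<Rightarrow> real"
  assumes fin: "finite I"
    and sub: "\<And>a b. \<Phi> a + (\<Sum>i\<in>I. g a i * (b i - a i)) \<le> \<Phi> b"
    and flow: "\<And>t i. 0 \<le> t \<Longrightarrow> i \<in> I \<Longrightarrow>
      ((\<lambda>s. v s i) has_real_derivative - g (v t) i) (at t within {0..})"
    and energy: "\<And>t. 0 \<le> t \<Longrightarrow>
      ((\<lambda>s. \<Phi> (v s)) has_real_derivative - (\<Sum>i\<in>I. (g (v t) i)\<^sup>2)) (at t within {0..})"
    and "i \<in> I"
  shows "\<exists>c. ((\<lambda>t. g (v t) i) \<longlongrightarrow> c) at_top"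
proof -
  define N where "N t = (\<Sum>i\<in>I. (g (v t) i)\<^sup>2)" for t
  have mono: "0 \<le> (\<Sum>i\<in>I. (g a i - g b i) * (a i - b i))" for a b
  proof -
    have "(\<Sum>i\<in>I. (g a i - g b i) * (a i - b i)) =
        - (\<Sum>i\<in>I. g a i * (b i - a i)) - (\<Sum>i\<in>I. g b i * (a i - b i))"
      unfolding sum_negf[symmetric] sum_subtractf[symmetric]
      by (intro sum.cong) (auto simp: algebra_simps)
    then show ?thesis using sub[of a b] sub[of b a] by simp
  qed
  have shift: "((\<lambda>s. v (s + h) i) has_real_derivative - g (v (t + h)) i) (at t within {0..})"
    if "0 \<le> t" "0 \<le> h" "i \<in> I" for t h i
  proof -
    have "((\<lambda>s. s + h) has_real_derivative 1) (at t within {0..})"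
      by (auto intro!: derivative_eq_intros)
    moreover have "((\<lambda>s. v s i) has_real_derivative - g (v (t + h)) i) (at (t + h) within (\<lambda>s. s + h) ` {0..})"
      using flow[of "t + h" i] that by (auto intro: DERIV_subset)
    ultimately show ?thesis using DERIV_image_chain[of "\<lambda>s. v s i" _ "\<lambda>s. s + h" t "{0..}" 1]
      by (simp add: o_def)
  qed
  \<comment> \<open>Trajectories of a monotone flow do not move apart. Comparing the flow with its
    own time shift by \<open>h\<close> and dividing by \<open>h\<close> shows that the squared speed
    \<open>N\<close> decreases, without differentiating \<open>g\<close>.\<close>
  have contr: "(\<Sum>i\<in>I. (v (t + h) i - v t i)\<^sup>2) \<le> (\<Sum>i\<in>I. (v (s + h) i - v s i)\<^sup>2)"
    if "0 \<le> s" "s \<le> t" "0 \<le> h" for s t h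
  proof (rule nonincreasing_ray[where T = 0 and f = "\<lambda>t. \<Sum>i\<in>I. (v (t + h) i - v t i)\<^sup>2"])
    show "((\<lambda>t. \<Sum>i\<in>I. (v (t + h) i - v t i)\<^sup>2) has_real_derivative
        (\<Sum>i\<in>I. - 2 * ((g (v (r + h)) i - g (v r) i) * (v (r + h) i - v r i)))) (at r within {0..})"
      if "0 \<le> r" for r
      using that \<open>0 \<le> h\<close>
      by (auto intro!: derivative_eq_intros flow shift sum.cong simp: algebra_simps)
    show "(\<Sum>i\<in>I. - 2 * ((g (v (r + h)) i - g (v r) i) * (v (r + h) i - v r i))) \<le> 0" for r
      using mono[of "v (r + h)" "v r"] unfolding sum_distrib_left[symmetric] by simp
  qed (use that in auto)
  have N_lim: "((\<lambda>h. \<Sum>i\<in>I. ((v (t + h) i - v t i) / h)\<^sup>2) \<longlongrightarrow> N t) (at_right 0)" if "0 \<le> t" for t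
  proof -
    have "((\<lambda>h. (v (t + h) i - v t i) / h) \<longlongrightarrow> - g (v t) i) (at_right 0)" if "i \<in> I" for i
    proof -
      have "((\<lambda>s. v s i) has_real_derivative - g (v t) i) (at_right t)"
        using flow[OF \<open>0 \<le> t\<close> that] by (rule DERIV_subset) (use \<open>0 \<le> t\<close> in auto)
      then have "((\<lambda>s. (v s i - v t i) / (s - t)) \<longlongrightarrow> - g (v t) i) (at_right t)"
        by (simp add: has_field_derivative_iff)
      then show ?thesis by (simp add: at_right_to_0[of t] filterlim_filtermap add.commute)
    qed
    then have "((\<lambda>h. \<Sum>i\<in>I. ((v (t + h) i - v t i) / h)\<^sup>2) \<longlongrightarrow> (\<Sum>i\<in>I. (- g (v t) i)\<^sup>2)) (at_right 0)"
      by (intro tendsto_intros)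
    then show ?thesis by (simp add: N_def)
  qed
  have N_mono: "N t \<le> N s" if "0 \<le> s" "s \<le> t" for s t
  proof (rule tendsto_le[OF _ N_lim N_lim])
    have "\<forall>\<^sub>F h in at_right (0::real). 0 < h" by (rule eventually_at_right_less)
    then show "\<forall>\<^sub>F h in at_right 0. (\<Sum>i\<in>I. ((v (t + h) i - v t i) / h)\<^sup>2)
        \<le> (\<Sum>i\<in>I. ((v (s + h) i - v s i) / h)\<^sup>2)"
    proof (rule eventually_mono)
      fix h :: real assume "0 < h"
      then show "(\<Sum>i\<in>I. ((v (t + h) i - v t i) / h)\<^sup>2) \<le> (\<Sum>i\<in>I. ((v (s + h) i - v s i) / h)\<^sup>2)"
        using contr[OF that, of h]
        by (simp add: power_divide sum_divide_distrib[symmetric] divide_right_mono)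
    qed
  qed (use that in auto)
  have "\<And>t. 0 \<le> N t" by (simp add: N_def sum_nonneg)
  with N_mono obtain L where L: "\<And>t. 0 \<le> t \<Longrightarrow> L \<le> N t"
    "\<And>\<epsilon>. 0 < \<epsilon> \<Longrightarrow> \<exists>S\<ge>0. \<forall>t\<ge>S. N t < L + \<epsilon>"
    using antimono_bounded_tail by metis
  define a where "a s t i = (v s i - v t i) / (t - s)" for s t i
  have close: "(g (v s) i - a s t i)\<^sup>2 \<le> 2 * (N s - L)" if st: "0 \<le> s" "s < t" and "i \<in> I" for s t i
  proof -
    have va: "v t i - v s i = - ((t - s) * a s t i)" for i using st by (simp add: a_def)
    \<comment> \<open>The potential falls at rate \<open>N\<close>, hence by at least
      \<open>L * (t - s)\<close>; the subgradient inequality at \<open>v s\<close> bounds the same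
      fall from above by the inner product of \<open>g (v s)\<close> and \<open>a s t\<close>, times
      \<open>t - s\<close>.\<close>
    have "\<Phi> (v t) + L * t \<le> \<Phi> (v s) + L * s"
    proof (rule nonincreasing_ray[where T = 0 and f = "\<lambda>t. \<Phi> (v t) + L * t"])
      show "((\<lambda>t. \<Phi> (v t) + L * t) has_real_derivative - N r + L) (at r within {0..})" if "0 \<le> r" for r
        using energy[OF that] by (auto intro!: derivative_eq_intros simp: N_def)
    qed (use st L in auto)
    moreover have "\<Phi> (v s) - (t - s) * (\<Sum>i\<in>I. g (v s) i * a s t i) \<le> \<Phi> (v t)"
      using sub[of "v s" "v t"] unfolding va
      by (simp add: sum_distrib_left sum_negf mult.left_commute)
    ultimately have "(t - s) * L \<le> (t - s) * (\<Sum>i\<in>I. g (v s) i * a s t i)"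
      by (simp add: algebra_simps)
    then have inner: "L \<le> (\<Sum>i\<in>I. g (v s) i * a s t i)" using st by simp
    \<comment> \<open>The mean value theorem for the scalar product with the fixed vector
      \<open>a s t\<close> yields a time \<open>r\<close> where the squared norm of
      \<open>a s t\<close> equals its product with \<open>g (v r)\<close>. Young's inequality then
      bounds that norm by \<open>N r\<close>, with no integral involved.\<close>
    have "((\<lambda>r. \<Sum>i\<in>I. a s t i * v r i) has_real_derivative - (\<Sum>i\<in>I. a s t i * g (v r) i)) (at r within {0..})"
      if "0 \<le> r" for r
      unfolding sum_negf[symmetric] using that by (auto intro!: derivative_eq_intros flow sum.cong)
    from mvt_ray[OF this st] obtain r where r: "s < r" "r < t"
      "(\<Sum>i\<in>I. a s t i * v t i) - (\<Sum>i\<in>I. a s t i * v s i) = (t - s) * - (\<Sum>i\<in>I. a s t i * g (v r) i)"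
      by blast
    have "(\<Sum>i\<in>I. a s t i * v t i) - (\<Sum>i\<in>I. a s t i * v s i) = - ((t - s) * (\<Sum>i\<in>I. (a s t i)\<^sup>2))"
      unfolding sum_subtractf[symmetric] right_diff_distrib[symmetric] va
      by (simp add: sum_distrib_left sum_negf power2_eq_square mult.left_commute)
    then have "(t - s) * (\<Sum>i\<in>I. (a s t i)\<^sup>2) = (t - s) * (\<Sum>i\<in>I. a s t i * g (v r) i)"
      using r(3) by linarith
    then have "(\<Sum>i\<in>I. (a s t i)\<^sup>2) = (\<Sum>i\<in>I. a s t i * g (v r) i)" using st by simp
    moreover have "(\<Sum>i\<in>I. a s t i * g (v r) i) \<le> (\<Sum>i\<in>I. ((a s t i)\<^sup>2 + (g (v r) i)\<^sup>2) / 2)"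
    proof (rule sum_mono)
      fix i
      show "a s t i * g (v r) i \<le> ((a s t i)\<^sup>2 + (g (v r) i)\<^sup>2) / 2"
        using sum_squares_bound[of "a s t i" "g (v r) i"] by simp
    qed
    ultimately have "(\<Sum>i\<in>I. (a s t i)\<^sup>2) \<le> N r"
      by (simp add: N_def sum.distrib sum_divide_distrib[symmetric])
    then have norm: "(\<Sum>i\<in>I. (a s t i)\<^sup>2) \<le> N s" using N_mono[of s r] st r by simp
    have "(g (v s) i - a s t i)\<^sup>2 \<le> (\<Sum>i\<in>I. (g (v s) i - a s t i)\<^sup>2)"
      using fin \<open>i \<in> I\<close> by (intro member_le_sum) auto
    also have "\<dots> = N s + (\<Sum>i\<in>I. (a s t i)\<^sup>2) - 2 * (\<Sum>i\<in>I. g (v s) i * a s t i)"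
      by (simp add: power2_diff sum.distrib sum_subtractf sum_distrib_left N_def algebra_simps)
    finally show ?thesis using inner norm by simp
  qed
  show ?thesis
  proof (rule real_cauchy_at_top_converges)
    fix \<epsilon> :: real assume "0 < \<epsilon>"
    \<comment> \<open>Chosen so that the bound \<open>2 * (N s - L)\<close> of \<open>close\<close>
      is below the square of \<open>\<epsilon> / 8\<close>. The midpoint identity below adds up four
      such errors, the one of \<open>a s (2 * t - s)\<close> being counted twice, for a total of
      \<open>\<epsilon> / 2\<close>.\<close>
    then obtain S where S: "0 \<le> S" "\<forall>t\<ge>S. N t < L + (\<epsilon> / 8)\<^sup>2 / 2"
      using L(2)[of "(\<epsilon> / 8)\<^sup>2 / 2"] by auto
    have near: "\<bar>g (v s) i - a s t i\<bar> \<le> \<epsilon> / 8" if "S \<le> s" "s < t" for s t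
    proof (rule power2_le_imp_le)
      show "\<bar>g (v s) i - a s t i\<bar>\<^sup>2 \<le> (\<epsilon> / 8)\<^sup>2"
        using close[of s t i] that S \<open>i \<in> I\<close> by (simp add: field_simps) (smt (verit))
    qed (use \<open>0 < \<epsilon>\<close> in simp)
    have "\<bar>g (v t) i - g (v s) i\<bar> < \<epsilon>" if "S \<le> s" "s \<le> t" for s t
    proof (cases "s = t")
      case False
      then have "s < t" using that by simp
      have "2 * a s (2 * t - s) i = a s t i + a t (2 * t - s) i"
        using \<open>s < t\<close> by (simp add: a_def divide_simps) (simp add: algebra_simps)
      then show ?thesis
        using near[of s t] near[of s "2 * t - s"] near[of t "2 * t - s"] that \<open>s < t\<close> \<open>0 < \<epsilon>\<close>
        by linarith
    qed (use \<open>0 < \<epsilon>\<close> in simp)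
    then show "\<exists>S. \<forall>s\<ge>S. \<forall>t\<ge>s. \<bar>g (v t) i - g (v s) i\<bar> < \<epsilon>" by blast
  qed
qed

text \<open>\<open>Q = \<bar>y - z\<bar>\<^sup>2\<close> satisfies \<open>Q' \<le> M e\<^bsup>-\<delta>t\<^esup> (card I + Q)\<close>, so
  \<open>(card I + Q) exp (M e\<^bsup>-\<delta>t\<^esup> / \<delta>)\<close> is nonincreasing.\<close>

lemma perturbed_monotone_flow_bounded:
  fixes y r :: "real \<Rightarrow> 'i \<Rightarrow> real"
  assumes fin: "finite I" and T: "0 \<le> T" and \<delta>: "0 < \<delta>"
    and flow: "\<And>t i. 0 \<le> t \<Longrightarrow> i \<in> I \<Longrightarrow>
      ((\<lambda>s. y s i) has_real_derivative r t i - h t i) (at t within {0..})"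
    and mono: "\<And>t. 0 \<le> t \<Longrightarrow> 0 \<le> (\<Sum>i\<in>I. h t i * (y t i - z i))"
    and err: "\<And>t i. T \<le> t \<Longrightarrow> i \<in> I \<Longrightarrow> \<bar>r t i\<bar> \<le> M * exp (- \<delta> * t)"
  shows "\<exists>B. \<forall>t\<ge>T. \<forall>i\<in>I. \<bar>y t i - z i\<bar> \<le> B"
proof -
  define Q where "Q t = (\<Sum>i\<in>I. (y t i - z i)\<^sup>2)" for t
  define M' where "M' = \<bar>M\<bar>"
  define X where "X t = exp (M' * exp (- \<delta> * t) / \<delta>)" for t
  have "0 \<le> M'" by (simp add: M'_def)
  have err': "\<bar>r t i\<bar> \<le> M' * exp (- \<delta> * t)" if "T \<le> t" "i \<in> I" for t i
    
    by (rule order_trans[OF err[OF that]]) (simp add: M'_def)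
  let ?Q' = "\<lambda>t. \<Sum>i\<in>I. 2 * (r t i - h t i) * (y t i - z i)"
  have dQ: "(Q has_real_derivative ?Q' t) (at t within {0..})" if "0 \<le> t" for t
    unfolding Q_def using that by (auto intro!: derivative_eq_intros flow sum.cong)
  have Q'_le: "?Q' t \<le> M' * exp (- \<delta> * t) * (card I + Q t)" if "T \<le> t" for t
  proof -
    have "?Q' t = 2 * (\<Sum>i\<in>I. r t i * (y t i - z i)) - 2 * (\<Sum>i\<in>I. h t i * (y t i - z i))"
      unfolding sum_distrib_left sum_subtractf[symmetric] by (intro sum.cong) (auto simp: algebra_simps)
    also have "\<dots> \<le> (\<Sum>i\<in>I. 2 * (r t i * (y t i - z i)))"
      using mono[of t] that T by (simp add: sum_distrib_left[symmetric])
    \<comment> \<open>From \<open>2 * x \<le> 1 + x * x\<close>: the constants 1 add up to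
      \<open>card I\<close>. Working with \<open>card I + Q\<close> avoids differentiating a square
      root of \<open>Q\<close>.\<close>
    also have "\<dots> \<le> (\<Sum>i\<in>I. M' * exp (- \<delta> * t) * (1 + (y t i - z i)\<^sup>2))"
    proof (rule sum_mono)
      fix i assume "i \<in> I"
      have "2 * (r t i * (y t i - z i)) \<le> \<bar>r t i\<bar> * (2 * \<bar>y t i - z i\<bar>)"
        using abs_ge_self[of "r t i * (y t i - z i)"] by (simp add: abs_mult)
      also have "\<dots> \<le> M' * exp (- \<delta> * t) * (1 + (y t i - z i)\<^sup>2)"
        using err'[OF that \<open>i \<in> I\<close>] sum_squares_bound[of 1 "\<bar>y t i - z i\<bar>"] by (intro mult_mono) auto
      finally show "2 * (r t i * (y t i - z i)) \<le> M' * exp (- \<delta> * t) * (1 + (y t i - z i)\<^sup>2)" .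
    qed
    also have "\<dots> = M' * exp (- \<delta> * t) * (card I + Q t)"
      by (simp add: sum_distrib_left[symmetric] sum.distrib Q_def)
    finally show ?thesis .
  qed
  have dX: "(X has_real_derivative - (M' * exp (- \<delta> * t)) * X t) (at t within {0..})" for t
    unfolding X_def using \<delta> by (auto intro!: derivative_eq_intros)
  have bound: "(card I + Q t) * X t \<le> (card I + Q T) * X T" if "T \<le> t" for t
  proof (rule nonincreasing_ray[where T = T and f = "\<lambda>t. (card I + Q t) * X t"])
    show "((\<lambda>t. (card I + Q t) * X t) has_real_derivative
        (?Q' t - M' * exp (- \<delta> * t) * (card I + Q t)) * X t) (at t within {0..})" if "0 \<le> t" for t
      using that by (auto intro!: derivative_eq_intros dQ dX simp: algebra_simps)
    show "(?Q' t - M' * exp (- \<delta> * t) * (card I + Q t)) * X t \<le> 0" if "T \<le> t" for t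
      using Q'_le[OF that] by (intro mult_nonpos_nonneg) (auto simp: X_def)
  qed (use that T in auto)
  have Q0: "0 \<le> Q t" for t by (simp add: Q_def sum_nonneg)
  have "\<bar>y t i - z i\<bar> \<le> sqrt ((card I + Q T) * X T)" if "T \<le> t" "i \<in> I" for t i
  proof (rule real_le_rsqrt)
    have "1 \<le> X t" using \<delta> \<open>0 \<le> M'\<close> by (simp add: X_def)
    have "\<bar>y t i - z i\<bar>\<^sup>2 \<le> Q t" unfolding Q_def
      using fin that(2) member_le_sum[of i I "\<lambda>i. (y t i - z i)\<^sup>2"] by simp
    also have "\<dots> \<le> (card I + Q t) * 1" by simp
    also have "\<dots> \<le> (card I + Q t) * X t" using \<open>1 \<le> X t\<close> Q0 by (intro mult_left_mono) auto
    finally show "\<bar>y t i - z i\<bar>\<^sup>2 \<le> (card I + Q T) * X T" using bound[OF that(1)] by simp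
  qed
  then show ?thesis by blast
qed

text \<open>With the distance to \<open>z\<close> already bounded, the error adds only an integrable
  amount to the derivative of \<open>Q\<close>. So \<open>Q\<close> plus a vanishing correction is
  nonincreasing, and being small at one time of the sequence it stays small.\<close>

lemma perturbed_monotone_flow_converges:
  fixes y r :: "real \<Rightarrow> 'i \<Rightarrow> real" and \<tau> :: "nat \<Rightarrow> real"
  assumes fin: "finite I" and T: "0 \<le> T" and \<delta>: "0 < \<delta>"
    and flow: "\<And>t i. 0 \<le> t \<Longrightarrow> i \<in> I \<Longrightarrow>
      ((\<lambda>s. y s i) has_real_derivative r t i - h t i) (at t within {0..})"
    and mono: "\<And>t. 0 \<le> t \<Longrightarrow> 0 \<le> (\<Sum>i\<in>I. h t i * (y t i - z i))"
    and err: "\<And>t i. T \<le> t \<Longrightarrow> i \<in> I \<Longrightarrow> \<bar>r t i\<bar> \<le> M * exp (- \<delta> * t)"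
    and \<tau>: "filterlim \<tau> at_top sequentially" "\<And>i. i \<in> I \<Longrightarrow> (\<lambda>j. y (\<tau> j) i) \<longlonglongrightarrow> z i"
    and "i \<in> I"
  shows "((\<lambda>t. y t i) \<longlongrightarrow> z i) at_top"
proof -
  obtain B where B: "\<forall>t\<ge>T. \<forall>i\<in>I. \<bar>y t i - z i\<bar> \<le> B"
    using perturbed_monotone_flow_bounded[OF fin T \<delta> flow mono err] by blast
  define Q where "Q t = (\<Sum>i\<in>I. (y t i - z i)\<^sup>2)" for t
  \<comment> \<open>\<open>K * exp (- \<delta> * t)\<close> bounds the contribution of the error to
    the derivative of \<open>Q\<close>; the correction in \<open>R\<close> is the integral of this
    bound from \<open>t\<close> to infinity.\<close>
  define K where "K = card I * (2 * (\<bar>M\<bar> * \<bar>B\<bar>))"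
  define R where "R t = Q t + K / \<delta> * exp (- \<delta> * t)" for t
  have R_mono: "R t \<le> R s" if "T \<le> s" "s \<le> t" for s t
  proof (rule nonincreasing_ray[where T = T and f = R])
    let ?Q' = "\<lambda>t. \<Sum>i\<in>I. 2 * (r t i - h t i) * (y t i - z i)"
    show "(R has_real_derivative ?Q' t - K * exp (- \<delta> * t)) (at t within {0..})" if "0 \<le> t" for t
      unfolding R_def Q_def using that \<delta> by (auto intro!: derivative_eq_intros flow sum.cong)
    show "?Q' t - K * exp (- \<delta> * t) \<le> 0" if "T \<le> t" for t
    proof -
      have "?Q' t = 2 * (\<Sum>i\<in>I. r t i * (y t i - z i)) - 2 * (\<Sum>i\<in>I. h t i * (y t i - z i))"
        unfolding sum_distrib_left sum_subtractf[symmetric] by (intro sum.cong) (auto simp: algebra_simps)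
      also have "\<dots> \<le> (\<Sum>i\<in>I. 2 * (r t i * (y t i - z i)))"
        using mono[of t] that T by (simp add: sum_distrib_left[symmetric])
      also have "\<dots> \<le> (\<Sum>i\<in>I. 2 * (\<bar>M\<bar> * \<bar>B\<bar>) * exp (- \<delta> * t))"
      proof (rule sum_mono)
        fix i assume "i \<in> I"
        have "r t i * (y t i - z i) \<le> \<bar>r t i\<bar> * \<bar>y t i - z i\<bar>"
          using abs_ge_self[of "r t i * (y t i - z i)"] by (simp add: abs_mult)
        also have "\<dots> \<le> (\<bar>M\<bar> * exp (- \<delta> * t)) * \<bar>B\<bar>"
        proof (rule mult_mono)
          show "\<bar>r t i\<bar> \<le> \<bar>M\<bar> * exp (- \<delta> * t)"
            
            by (rule order_trans[OF err[OF that \<open>i \<in> I\<close>]]) simp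
          show "\<bar>y t i - z i\<bar> \<le> \<bar>B\<bar>" using B that \<open>i \<in> I\<close> by force
        qed auto
        finally show "2 * (r t i * (y t i - z i)) \<le> 2 * (\<bar>M\<bar> * \<bar>B\<bar>) * exp (- \<delta> * t)"
          by (simp add: ac_simps)
      qed
      finally show ?thesis by (simp add: K_def)
    qed
  qed (use that T in auto)
  have "((\<lambda>t. exp (- \<delta> * t)) \<longlongrightarrow> 0) at_top"
    by (intro filterlim_compose[OF exp_at_bot] filterlim_tendsto_neg_mult_at_bot[OF tendsto_const _ filterlim_ident])
      (use \<delta> in simp)
  then have e0: "(\<lambda>j. exp (- \<delta> * \<tau> j)) \<longlonglongrightarrow> 0" using \<tau>(1) by (rule filterlim_compose)
  have "(\<lambda>j. R (\<tau> j)) \<longlonglongrightarrow> (\<Sum>i\<in>I. (z i - z i)\<^sup>2) + K / \<delta> * 0"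
    unfolding R_def Q_def by (intro tendsto_intros e0 \<tau>(2))
  then have R0: "(\<lambda>j. R (\<tau> j)) \<longlonglongrightarrow> 0" by simp
  have Q_le: "(y t i - z i)\<^sup>2 \<le> R t" for t
  proof -
    have "0 \<le> K / \<delta> * exp (- \<delta> * t)" using \<delta> by (simp add: K_def)
    moreover have "(y t i - z i)\<^sup>2 \<le> Q t" unfolding Q_def
      using fin \<open>i \<in> I\<close> by (intro member_le_sum) auto
    ultimately show ?thesis by (simp add: R_def)
  qed
  show ?thesis
  proof (rule tendstoI)
    fix \<epsilon> :: real assume "0 < \<epsilon>"
    then have "\<forall>\<^sub>F j in sequentially. R (\<tau> j) < \<epsilon>\<^sup>2" using R0 by (intro order_tendstoD) auto
    moreover have "\<forall>\<^sub>F j in sequentially. T \<le> \<tau> j"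
      using \<tau>(1) by (simp add: filterlim_at_top)
    ultimately have "\<exists>j. R (\<tau> j) < \<epsilon>\<^sup>2 \<and> T \<le> \<tau> j"
      by (intro eventually_happens'[OF sequentially_bot] eventually_conj)
    then obtain j where j: "R (\<tau> j) < \<epsilon>\<^sup>2" "T \<le> \<tau> j" by blast
    have "dist (y t i) (z i) < \<epsilon>" if "\<tau> j \<le> t" for t
    proof -
      have "\<bar>y t i - z i\<bar>\<^sup>2 < \<epsilon>\<^sup>2"
        using Q_le[of t] R_mono[OF j(2) that] j(1) by simp
      then show ?thesis using \<open>0 < \<epsilon>\<close> power2_less_imp_less[of "\<bar>y t i - z i\<bar>" \<epsilon>]
        by (simp add: dist_real_def)
    qed
    then show "\<forall>\<^sub>F t in at_top. dist (y t i) (z i) < \<epsilon>"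
      by (auto simp: eventually_at_top_linorder)
  qed
qed

lemma bounded_family_convergent_subseq:
  fixes y :: "nat \<Rightarrow> 'i \<Rightarrow> real"
  assumes "finite I" "\<And>i. i \<in> I \<Longrightarrow> Bseq (\<lambda>n. y n i)"
  shows "\<exists>r. strict_mono r \<and> (\<forall>i\<in>I. convergent (\<lambda>n. y (r n) i))"
  using assms
proof (induction I)
  case empty
  show ?case by (auto intro: exI[of _ id] simp: strict_mono_id)
next
  case (insert k I)
  then obtain r where r: "strict_mono r" "\<forall>i\<in>I. convergent (\<lambda>n. y (r n) i)" by auto
  have "Bseq (\<lambda>n. y (r n) k)" using insert.prems Bseq_subseq[of "\<lambda>n. y n k" r] by simp
  moreover obtain r' :: "nat \<Rightarrow> nat" where r': "strict_mono r'" "monoseq (\<lambda>n. y (r (r' n)) k)"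
    using seq_monosub[of "\<lambda>n. y (r n) k"] by auto
  ultimately have "convergent (\<lambda>n. y (r (r' n)) k)"
    using Bseq_subseq[of "\<lambda>n. y (r n) k" r'] Bseq_monoseq_convergent by blast
  moreover have "convergent (\<lambda>n. y (r (r' n)) i)" if "i \<in> I" for i
    using convergent_subseq_convergent[OF r(2)[rule_format, OF that] r'(1)] by (simp add: o_def)
  moreover have "strict_mono (\<lambda>n. r (r' n))" using r(1) r'(1) by (simp add: strict_mono_def)
  ultimately show ?case by (intro exI[of _ "\<lambda>n. r (r' n)"]) auto
qed

section \<open>Curvature as the gradient of a convex potential\<close>

lemma face_curv_cong:
  assumes "e \<in> C" "\<And>f. f \<in> C \<Longrightarrow> p f = q f"
  shows "face_curv E C p e = face_curv E C q e"
proof -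
  have "(\<Sum>f\<in>incident E x. 1 / p f) = (\<Sum>f\<in>incident E x. 1 / q f)" if "incident E x \<subseteq> C" for x
    using that assms(2) by (auto intro!: sum.cong)
  then show ?thesis using assms by (auto simp: face_curv_def intro!: sum.cong)
qed

text \<open>In logarithmic coordinates this is invariance under adding a constant, so neither the
  normalization nor the shift by \<open>c * t\<close> affects the gradient.\<close>

lemma face_curv_scale:
  assumes "k \<noteq> 0"
  shows "face_curv E C (\<lambda>f. k * p f) e = face_curv E C p e"
proof -
  have *: "k * p e * (\<Sum>f\<in>incident E x. 1 / (k * p f)) = p e * (\<Sum>f\<in>incident E x. 1 / p f)" for x
    using assms unfolding sum_distrib_left by (intro sum.cong) auto
  show ?thesis by (simp only: face_curv_def *)
qed

text \<open>Jensen's inequality for \<open>exp\<close> under the probability weights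
  \<open>p\<close>, obtained from the tangent line of \<open>exp\<close> at the mean
  \<open>m\<close> of \<open>a - b\<close>.\<close>

lemma log_sum_exp_subgradient:
  fixes a b :: "'i \<Rightarrow> real"
  assumes "finite J" "J \<noteq> {}"
  defines "p \<equiv> \<lambda>j. exp (- a j) / (\<Sum>k\<in>J. exp (- a k))"
  shows "ln (\<Sum>j\<in>J. exp (- a j)) - (\<Sum>j\<in>J. p j * (b j - a j)) \<le> ln (\<Sum>j\<in>J. exp (- b j))"
proof -
  let ?A = "\<Sum>k\<in>J. exp (- a k)" and ?B = "\<Sum>k\<in>J. exp (- b k)"
  have A: "0 < ?A" and B: "0 < ?B" using assms by (auto intro!: sum_pos)
  have p: "(\<Sum>j\<in>J. p j) = 1" using A by (simp add: p_def sum_divide_distrib[symmetric])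
  define m where "m = (\<Sum>j\<in>J. p j * (a j - b j))"
  \<comment> \<open>The bracket equals 1 because the weights sum to 1; in this shape it is the
    average of the tangent line values.\<close>
  have "exp m = exp m * ((\<Sum>j\<in>J. p j) + (m - m * (\<Sum>j\<in>J. p j)))" by (simp add: p)
  also have "\<dots> = (\<Sum>j\<in>J. p j * (exp m * (1 + (a j - b j - m))))"
    unfolding m_def sum_distrib_left
    by (simp add: algebra_simps sum.distrib sum_subtractf sum_distrib_left sum_distrib_right)
  also have "\<dots> \<le> (\<Sum>j\<in>J. p j * exp (a j - b j))"
  proof (intro sum_mono mult_left_mono)
    fix j
    have "exp m * (1 + (a j - b j - m)) \<le> exp m * exp (a j - b j - m)"
      by (intro mult_left_mono exp_ge_add_one_self) simp
    then show "exp m * (1 + (a j - b j - m)) \<le> exp (a j - b j)"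
      by (simp add: mult_exp_exp)
    show "0 \<le> p j" using A by (simp add: p_def)
  qed
  also have "\<dots> = (\<Sum>j\<in>J. exp (- b j) / ?A)"
    by (intro sum.cong) (auto simp: p_def mult_exp_exp)
  finally have "exp m \<le> ?B / ?A" by (simp add: sum_divide_distrib)
  then have "m \<le> ln (?B / ?A)" using A B by (simp add: ln_ge_iff)
  also have "\<dots> = ln ?B - ln ?A" using A B by (simp add: ln_div)
  moreover have "m = - (\<Sum>j\<in>J. p j * (b j - a j))"
    unfolding m_def sum_negf[symmetric] by (simp add: algebra_simps)
  ultimately show ?thesis by simp
qed

section \<open>The convex potential of a face\<close>

locale finite_edges =
  fixes E :: "'a set set"
  assumes finite_E: "finite E" and finite_edge: "\<forall>e\<in>E. finite e"
begin

text \<open>Restricting to \<open>\<Union>E\<close> keeps the set finite and excludes points without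
  edges, whose empty edge set lies in every \<open>C\<close>.\<close>

definition face_vertices :: "'a set set \<Rightarrow> 'a set" where
  "face_vertices C = {x \<in> \<Union>E. incident E x \<subseteq> C}"

definition potential :: "'a set set \<Rightarrow> ('a set \<Rightarrow> real) \<Rightarrow> real" where
  "potential C u = (\<Sum>x\<in>face_vertices C.
     (real (degree E x) - 2) * ln (\<Sum>f\<in>incident E x. exp (- u f)))"

abbreviation gradient :: "'a set set \<Rightarrow> ('a set \<Rightarrow> real) \<Rightarrow> 'a set \<Rightarrow> real" where
  "gradient C u \<equiv> face_curv E C (\<lambda>f. exp (u f))"

lemma finite_face_vertices: "finite (face_vertices C)"
  using finite_E finite_edge by (auto simp: face_vertices_def)

lemma finite_incident: "finite (incident E x)"
  using finite_E by (simp add: incident_def)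

lemma incident_nonempty: "x \<in> face_vertices C \<Longrightarrow> incident E x \<noteq> {}"
  by (auto simp: face_vertices_def incident_def)

lemma gradient_eq:
  assumes "e \<in> E"
  shows "gradient C u e = (\<Sum>x | x \<in> face_vertices C \<and> x \<in> e.
    (2 - real (degree E x)) * (exp (- u e) / (\<Sum>f\<in>incident E x. exp (- u f))))"
proof -
  have "{x. x \<in> e \<and> incident E x \<subseteq> C} = {x. x \<in> face_vertices C \<and> x \<in> e}"
    using assms by (auto simp: face_vertices_def)
  then show ?thesis by (simp add: face_curv_def exp_minus field_simps)
qed

text \<open>Double counting of incidences. Each vertex contributes a weighted mean of
  \<open>h\<close> over its edges, so convexity can be checked vertex by vertex, and
  \<open>h = 1\<close> gives the total curvature.\<close>

lemma sum_gradient: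
  "(\<Sum>e\<in>E. gradient C u e * h e) = (\<Sum>x\<in>face_vertices C. (2 - real (degree E x)) *
    (\<Sum>e\<in>incident E x. exp (- u e) / (\<Sum>f\<in>incident E x. exp (- u f)) * h e))"
proof -
  let ?p = "\<lambda>x e. exp (- u e) / (\<Sum>f\<in>incident E x. exp (- u f))"
  have "(\<Sum>e\<in>E. gradient C u e * h e) =
      (\<Sum>e\<in>E. \<Sum>x | x \<in> face_vertices C \<and> x \<in> e. (2 - real (degree E x)) * ?p x e * h e)"
    by (intro sum.cong) (auto simp: gradient_eq sum_distrib_right)
  also have "\<dots> = (\<Sum>x\<in>face_vertices C. \<Sum>e | e \<in> E \<and> x \<in> e. (2 - real (degree E x)) * ?p x e * h e)"
    using finite_E finite_face_vertices by (rule sum.swap_restrict)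
  finally show ?thesis by (simp add: incident_def sum_distrib_left mult.assoc)
qed

text \<open>A leaf has the negative coefficient \<open>-1\<close>, but its logarithmic term is linear.\<close>

lemma potential_subgradient:
  "potential C a + (\<Sum>e\<in>E. gradient C a e * (b e - a e)) \<le> potential C b"
proof -
  let ?p = "\<lambda>x e. exp (- a e) / (\<Sum>f\<in>incident E x. exp (- a f))"
  let ?l = "\<lambda>u x. ln (\<Sum>f\<in>incident E x. exp (- u f))"
  have "(real (degree E x) - 2) * ?l a x +
      (2 - real (degree E x)) * (\<Sum>e\<in>incident E x. ?p x e * (b e - a e))
      \<le> (real (degree E x) - 2) * ?l b x" if "x \<in> face_vertices C" for x
  proof -
    have ne: "incident E x \<noteq> {}" by (rule incident_nonempty[OF that])
    let ?r = "?l b x - (?l a x - (\<Sum>e\<in>incident E x. ?p x e * (b e - a e)))"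
    have "0 \<le> (real (degree E x) - 2) * ?r"
    proof (cases "degree E x = 1")
      case True
      then obtain e where "incident E x = {e}" unfolding degree_def by (auto simp: card_1_singleton_iff)
      then show ?thesis by simp
    next
      case False
      moreover have "degree E x \<noteq> 0" using ne finite_incident by (simp add: degree_def)
      ultimately have "2 \<le> degree E x" by simp
      moreover have "0 \<le> ?r" using log_sum_exp_subgradient[OF finite_incident ne, of a b] by simp
      ultimately show ?thesis by simp
    qed
    then show ?thesis by (simp add: algebra_simps)
  qed
  then show ?thesis unfolding sum_gradient potential_def sum.distrib[symmetric] by (intro sum_mono)
qed

text \<open>The sum of the subgradient inequalities at \<open>a\<close> and at \<open>b\<close>.
  Edges outside \<open>C\<close> drop out because they meet no vertex of the face.\<close>

lemma gradient_monotone: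
  assumes "C \<subseteq> E"
  shows "0 \<le> (\<Sum>e\<in>C. (gradient C a e - gradient C b e) * (a e - b e))"
proof -
  have "gradient C u e = 0" if "e \<in> E - C" for e u
    unfolding gradient_eq[of e, OF DiffD1[OF that]]
    by (rule sum.neutral) (use that in \<open>auto simp: face_vertices_def incident_def\<close>)
  then have "(\<Sum>e\<in>C. (gradient C a e - gradient C b e) * (a e - b e)) =
      (\<Sum>e\<in>E. (gradient C a e - gradient C b e) * (a e - b e))"
    using assms finite_E by (intro sum.mono_neutral_left) auto
  also have "\<dots> = - (\<Sum>e\<in>E. gradient C a e * (b e - a e)) - (\<Sum>e\<in>E. gradient C b e * (a e - b e))"
    unfolding sum_negf[symmetric] sum_subtractf[symmetric]
    by (intro sum.cong) (auto simp: algebra_simps)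
  finally show ?thesis using potential_subgradient[of C a b] potential_subgradient[of C b a] by simp
qed

lemma potential_derivative:
  assumes "\<And>e. e \<in> E \<Longrightarrow> ((\<lambda>s. v s e) has_real_derivative v' e) (at t within S)"
  shows "((\<lambda>s. potential C (v s)) has_real_derivative (\<Sum>e\<in>E. gradient C (v t) e * v' e)) (at t within S)"
proof -
  have "((\<lambda>s. (real (degree E x) - 2) * ln (\<Sum>f\<in>incident E x. exp (- v s f))) has_real_derivative
     (2 - real (degree E x)) *
    (\<Sum>e\<in>incident E x. exp (- v t e) / (\<Sum>f\<in>incident E x. exp (- v t f)) * v' e)) (at t within S)"
    if x: "x \<in> face_vertices C" for x
  proof -
    let ?Z = "\<Sum>f\<in>incident E x. exp (- v t f)"
    have Z: "0 < ?Z" using finite_incident incident_nonempty[OF x] by (intro sum_pos) auto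
    have "((\<lambda>s. \<Sum>f\<in>incident E x. exp (- v s f)) has_real_derivative
        (\<Sum>f\<in>incident E x. exp (- v t f) * - v' f)) (at t within S)"
      by (intro DERIV_sum) (auto intro!: derivative_eq_intros assms simp: incident_def)
    then have "((\<lambda>s. (real (degree E x) - 2) * ln (\<Sum>f\<in>incident E x. exp (- v s f))) has_real_derivative
       (real (degree E x) - 2) * (1 / ?Z * (\<Sum>f\<in>incident E x. exp (- v t f) * - v' f))) (at t within S)"
      using Z by (intro DERIV_cmult DERIV_chain'[OF _ DERIV_ln_divide]) auto
    moreover have "(real (degree E x) - 2) * (1 / ?Z * (\<Sum>f\<in>incident E x. exp (- v t f) * - v' f)) =
        (2 - real (degree E x)) * (\<Sum>e\<in>incident E x. exp (- v t e) / ?Z * v' e)"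
      unfolding sum_distrib_left by (intro sum.cong) (auto simp: algebra_simps diff_divide_distrib)
    ultimately show ?thesis by simp
  qed
  then show ?thesis unfolding potential_def sum_gradient by (intro DERIV_sum)
qed

text \<open>Each vertex distributes \<open>2 - degree E x\<close> among its edges with weights of
  sum 1. That the total is independent of the metric makes the mean curvature explicitly integrable
  in time.\<close>

lemma sum_curv:
  assumes "\<forall>e\<in>E. 0 < p e"
  shows "(\<Sum>e\<in>E. face_curv E E p e) = (\<Sum>x\<in>\<Union>E. 2 - real (degree E x))"
proof -
  let ?u = "\<lambda>e. ln (p e)"
  have "(\<Sum>e\<in>E. face_curv E E p e) = (\<Sum>e\<in>E. gradient E ?u e * 1)"
    using assms by (intro sum.cong) (auto intro!: face_curv_cong)
  also have "\<dots> = (\<Sum>x\<in>face_vertices E. 2 - real (degree E x))"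
  proof (unfold sum_gradient, rule sum.cong[OF refl])
    fix x assume "x \<in> face_vertices E"
    then have "0 < (\<Sum>f\<in>incident E x. exp (- ?u f))"
      using finite_incident incident_nonempty by (intro sum_pos) auto
    then show "(2 - real (degree E x)) * (\<Sum>e\<in>incident E x. exp (- ?u e) / (\<Sum>f\<in>incident E x. exp (- ?u f)) * 1)
        = 2 - real (degree E x)"
      by (simp add: sum_divide_distrib[symmetric])
  qed
  also have "face_vertices E = \<Union>E" by (auto simp: face_vertices_def incident_def)
  finally show ?thesis .
qed

text \<open>A lost vertex \<open>x\<close> has an edge \<open>f\<close> outside \<open>C\<close>.
  Its inverse weight alone makes \<open>p e\<close> times the sum of inverse weights at least
  \<open>p e / p f\<close>, so the term of \<open>x\<close> is at most \<eta> times its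
  coefficient.\<close>

lemma face_curv_error:
  assumes "C \<subseteq> E" "e \<in> C" and pos: "\<forall>f\<in>E. 0 < p f"
    and "0 \<le> \<eta>" and \<eta>: "\<And>f. f \<in> E - C \<Longrightarrow> p f / p e \<le> \<eta>"
  shows "\<bar>face_curv E E p e - face_curv E C p e\<bar> \<le> (\<Sum>x\<in>\<Union>E. \<bar>2 - real (degree E x)\<bar>) * \<eta>"
proof -
  let ?t = "\<lambda>x. (2 - real (degree E x)) / (p e * (\<Sum>f\<in>incident E x. 1 / p f))"
  have "e \<in> E" using assms by auto
  have fin: "finite e" using finite_edge \<open>e \<in> E\<close> by auto
  have "face_curv E E p e - face_curv E C p e = (\<Sum>x | x \<in> e \<and> \<not> incident E x \<subseteq> C. ?t x)"
  proof -
    have "{x. x \<in> e \<and> incident E x \<subseteq> E} = {x. x \<in> e \<and> incident E x \<subseteq> C} \<union> {x. x \<in> e \<and> \<not> incident E x \<subseteq> C}"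
      by (auto simp: incident_def)
    then have "face_curv E E p e =
        face_curv E C p e + (\<Sum>x | x \<in> e \<and> \<not> incident E x \<subseteq> C. ?t x)"
      unfolding face_curv_def using fin by (simp only:) (rule sum.union_disjoint, auto)
    then show ?thesis by simp
  qed
  also have "\<bar>\<dots>\<bar> \<le> (\<Sum>x | x \<in> e \<and> \<not> incident E x \<subseteq> C. \<bar>?t x\<bar>)" by (rule sum_abs)
  also have "\<dots> \<le> (\<Sum>x | x \<in> e \<and> \<not> incident E x \<subseteq> C. \<bar>2 - real (degree E x)\<bar> * \<eta>)"
  proof (rule sum_mono)
    fix x assume "x \<in> {x. x \<in> e \<and> \<not> incident E x \<subseteq> C}"
    then obtain f where f: "f \<in> incident E x" "f \<in> E - C" by (auto simp: incident_def)
    have pe: "0 < p e" and pf: "0 < p f" using pos \<open>e \<in> E\<close> f by auto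
    have "1 / p f \<le> (\<Sum>f\<in>incident E x. 1 / p f)"
      using f pos finite_incident
      by (intro member_le_sum[of f _ "\<lambda>f. 1 / p f"]) (auto simp: incident_def less_imp_le)
    then have le: "p e * (1 / p f) \<le> p e * (\<Sum>f\<in>incident E x. 1 / p f)" using pe
      by (intro mult_left_mono) auto
    then have "1 / (p e * (\<Sum>f\<in>incident E x. 1 / p f)) \<le> 1 / (p e * (1 / p f))"
      by (intro frac_le le) (use pe pf in auto)
    also have "\<dots> = p f / p e" by simp
    also have "\<dots> \<le> \<eta>" using \<eta>[OF f(2)] .
    finally have "1 / (p e * (\<Sum>f\<in>incident E x. 1 / p f)) \<le> \<eta>" .
    then have "\<bar>2 - real (degree E x)\<bar> * (1 / (p e * (\<Sum>f\<in>incident E x. 1 / p f))) \<le> \<bar>2 - real (degree E x)\<bar> * \<eta>"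
      by (intro mult_left_mono) auto
    moreover have "0 < p e * (\<Sum>f\<in>incident E x. 1 / p f)"
      by (rule less_le_trans[OF _ le]) (use pe pf in simp)
    ultimately show "\<bar>?t x\<bar> \<le> \<bar>2 - real (degree E x)\<bar> * \<eta>" by (simp add: abs_divide)
  qed
  also have "\<dots> \<le> (\<Sum>x\<in>\<Union>E. \<bar>2 - real (degree E x)\<bar> * \<eta>)"
    using finite_E finite_edge \<open>e \<in> E\<close> \<open>0 \<le> \<eta>\<close> by (intro sum_mono2) auto
  finally show ?thesis by (simp add: sum_distrib_right)
qed

lemma tendsto_face_curv:
  assumes "C \<subseteq> E" "e \<in> C" "\<And>f. f \<in> C \<Longrightarrow> ((\<lambda>t. p t f) \<longlongrightarrow> q f) F" "\<And>f. f \<in> C \<Longrightarrow> 0 < q f"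
  shows "((\<lambda>t. face_curv E C (p t) e) \<longlongrightarrow> face_curv E C q e) F"
  unfolding face_curv_def
proof (rule tendsto_sum)
  fix x assume "x \<in> {x. x \<in> e \<and> incident E x \<subseteq> C}"
  then have x: "incident E x \<subseteq> C" "e \<in> incident E x" using assms by (auto simp: incident_def)
  have "0 < (\<Sum>f\<in>incident E x. 1 / q f)"
    using x assms(4) finite_incident by (intro sum_pos) auto
  moreover have "q f \<noteq> 0" if "f \<in> incident E x" for f using assms(4)[of f] x that by auto
  ultimately show "((\<lambda>t. (2 - real (degree E x)) / (p t e * (\<Sum>f\<in>incident E x. 1 / p t f))) \<longlongrightarrow>
      (2 - real (degree E x)) / (q e * (\<Sum>f\<in>incident E x. 1 / q f))) F"
    using x assms(2,4) by (intro tendsto_intros assms(3)) (auto dest: assms(4))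
qed

end

section \<open>The normalized flow in logarithmic coordinates\<close>

context finite_edges
begin

text \<open>Subtracting \<open>A = (\<Sum>\<^sub>f ln w\<^sub>f + \<chi> t) / card E\<close>, an explicit antiderivative of the mean
  curvature, from \<open>ln w\<close> turns the normalized flow into a gradient flow.\<close>

lemma normalized_flow_log_coordinates:
  assumes "E \<noteq> {}"
    and pos: "\<And>t e. 0 \<le> t \<Longrightarrow> e \<in> E \<Longrightarrow> 0 < w t e"
    and init: "(\<Sum>e\<in>E. w 0 e) = 1"
    and flow: "\<And>t e. 0 \<le> t \<Longrightarrow> e \<in> E \<Longrightarrow> ((\<lambda>s. w s e) has_real_derivative
      - w t e * (face_curv E E (w t) e - (\<Sum>f\<in>E. w t f * face_curv E E (w t) f))) (at t within {0..})"
  obtains v where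
    "\<And>t e. 0 \<le> t \<Longrightarrow> e \<in> E \<Longrightarrow>
      ((\<lambda>s. v s e) has_real_derivative - gradient E (v t) e) (at t within {0..})"
    "\<And>t e. 0 \<le> t \<Longrightarrow> e \<in> E \<Longrightarrow> w t e = exp (v t e) / (\<Sum>f\<in>E. exp (v t f))"
    "\<And>t e. 0 \<le> t \<Longrightarrow> e \<in> E \<Longrightarrow> gradient E (v t) e = face_curv E E (w t) e"
proof -
  let ?\<kappa> = "\<lambda>t. face_curv E E (w t)"
  define \<chi> where "\<chi> = (\<Sum>x\<in>\<Union>E. 2 - real (degree E x))"
  define K where "K t = (\<Sum>f\<in>E. w t f * ?\<kappa> t f)" for t
  \<comment> \<open>Averaging the derivatives \<open>K t - ?\<kappa> t e\<close> of
    \<open>ln (w t e)\<close> over all edges and using that the curvatures sum to \<chi> recovers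
    \<open>K t\<close>.\<close>
  define A where "A t = ((\<Sum>f\<in>E. ln (w t f)) + \<chi> * t) / card E" for t
  define v where "v t e = ln (w t e) - A t" for t e
  have card: "real (card E) \<noteq> 0" using \<open>E \<noteq> {}\<close> finite_E by simp
  have d_ln: "((\<lambda>s. ln (w s e)) has_real_derivative K t - ?\<kappa> t e) (at t within {0..})"
    if "0 \<le> t" "e \<in> E" for t e
  proof -
    have "((\<lambda>s. ln (w s e)) has_real_derivative
        1 / w t e * (- w t e * (?\<kappa> t e - K t))) (at t within {0..})"
      using pos[OF that] unfolding K_def by (intro DERIV_chain'[OF flow[OF that] DERIV_ln_divide])
    then show ?thesis using pos[OF that] by simp
  qed
  have d_A: "(A has_real_derivative K t) (at t within {0..})" if "0 \<le> t" for t
  proof -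
    have "(\<Sum>e\<in>E. ?\<kappa> t e) = \<chi>" unfolding \<chi>_def using pos[OF that] by (intro sum_curv) auto
    then have "((\<Sum>e\<in>E. K t - ?\<kappa> t e) + \<chi>) / card E = K t"
      using card by (simp add: sum_subtractf)
    moreover have "(A has_real_derivative ((\<Sum>e\<in>E. K t - ?\<kappa> t e) + \<chi>) / card E) (at t within {0..})"
      unfolding A_def
      by (intro DERIV_cdivide DERIV_add DERIV_sum d_ln that) (auto intro!: derivative_eq_intros)
    ultimately show ?thesis by simp
  qed
  have exp_v: "w t e = exp (A t) * exp (v t e)" if "0 \<le> t" "e \<in> E" for t e
    using pos[OF that] by (simp add: v_def exp_diff)
  have grad: "gradient E (v t) e = ?\<kappa> t e" if "0 \<le> t" "e \<in> E" for t e
  proof -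
    have "?\<kappa> t e = face_curv E E (\<lambda>f. exp (A t) * exp (v t f)) e"
      using that exp_v by (intro face_curv_cong) auto
    then show ?thesis by (simp add: face_curv_scale)
  qed
  \<comment> \<open>The deviation of the total weight from 1 solves a linear equation with rate
    \<open>K t\<close>; \<open>exp (- A t)\<close> is its integrating factor, so \<open>D\<close> is
    constant and vanishes initially.\<close>
  define D where "D t = ((\<Sum>e\<in>E. w t e) - 1) * exp (- A t)" for t
  have d_D: "(D has_real_derivative 0) (at t within {0..})" if "0 \<le> t" for t
  proof -
    have "(\<Sum>e\<in>E. - w t e * (?\<kappa> t e - K t)) = K t * (\<Sum>e\<in>E. w t e) - (\<Sum>e\<in>E. w t e * ?\<kappa> t e)"
      unfolding sum_distrib_left sum_subtractf[symmetric]
      by (intro sum.cong) (auto simp: algebra_simps)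
    also have "\<dots> = K t * ((\<Sum>e\<in>E. w t e) - 1)"
      by (simp add: K_def[symmetric] right_diff_distrib)
    finally have eq: "(\<Sum>e\<in>E. - w t e * (?\<kappa> t e - K t)) = K t * ((\<Sum>e\<in>E. w t e) - 1)" .
    have "((\<lambda>s. \<Sum>e\<in>E. w s e) has_real_derivative (\<Sum>e\<in>E. - w t e * (?\<kappa> t e - K t))) (at t within {0..})"
      unfolding K_def by (intro DERIV_sum flow that)
    then have d_sum: "((\<lambda>s. \<Sum>e\<in>E. w s e) has_real_derivative K t * ((\<Sum>e\<in>E. w t e) - 1)) (at t within {0..})"
      unfolding eq .
    have "((\<lambda>s. exp (- A s)) has_real_derivative - K t * exp (- A t)) (at t within {0..})"
      by (auto intro!: derivative_eq_intros d_A that)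
    from DERIV_mult[OF DERIV_diff[OF d_sum DERIV_const[of 1]] this]
    show ?thesis unfolding D_def by (simp add: algebra_simps)
  qed
  have "(\<Sum>e\<in>E. w t e) = 1" if "0 \<le> t" for t
  proof -
    have "D t \<le> D 0" using that by (intro nonincreasing_ray[where f = D and f' = "\<lambda>_. 0" and T = 0])
        (auto intro!: d_D)
    moreover have "- D t \<le> - D 0"
      using that by (intro nonincreasing_ray[where f = "\<lambda>t. - D t" and f' = "\<lambda>_. 0" and T = 0])
        (auto intro!: derivative_eq_intros d_D)
    ultimately have "D t = 0" using init by (simp add: D_def)
    then show ?thesis by (simp add: D_def)
  qed
  then have A_eq: "exp (A t) * (\<Sum>f\<in>E. exp (v t f)) = 1" if "0 \<le> t" for t
    using that unfolding sum_distrib_left by (simp add: exp_v[symmetric])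
  have w_eq: "w t e = exp (v t e) / (\<Sum>f\<in>E. exp (v t f))" if "0 \<le> t" "e \<in> E" for t e
  proof -
    let ?Z = "\<Sum>f\<in>E. exp (v t f)"
    have "exp (A t) * ?Z = 1" by (rule A_eq[OF that(1)])
    then have "exp (A t) = 1 / ?Z" by (auto simp: eq_divide_eq)
    then show ?thesis using exp_v[OF that] by simp
  qed
  have d_v: "((\<lambda>s. v s e) has_real_derivative - gradient E (v t) e) (at t within {0..})"
    if "0 \<le> t" "e \<in> E" for t e
    unfolding grad[OF that] unfolding v_def using DERIV_diff[OF d_ln[OF that] d_A[OF that(1)]] by simp
  show ?thesis by (rule that[OF d_v w_eq grad])
qed

lemma gradient_converges:
  assumes flow: "\<And>t e. 0 \<le> t \<Longrightarrow> e \<in> E \<Longrightarrow>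
      ((\<lambda>s. v s e) has_real_derivative - gradient E (v t) e) (at t within {0..})"
    and "e \<in> E"
  shows "\<exists>c. ((\<lambda>t. gradient E (v t) e) \<longlongrightarrow> c) at_top"
proof (rule convex_gradient_flow_gradient_converges[where g = "gradient E" and \<Phi> = "potential E" and I = E])
  show "((\<lambda>s. v s e) has_real_derivative - gradient E (v t) e) (at t within {0..})"
    if "0 \<le> t" "e \<in> E" for t e using flow[OF that] .
  fix t :: real assume "0 \<le> t"
  show "((\<lambda>s. potential E (v s)) has_real_derivative - (\<Sum>e\<in>E. (gradient E (v t) e)\<^sup>2)) (at t within {0..})"
    using potential_derivative[OF flow[OF \<open>0 \<le> t\<close>], where C = E]
    by (simp add: power2_eq_square sum_negf)
qed (use finite_E potential_subgradient \<open>e \<in> E\<close> in auto)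

lemma normalized_flow_curvature_converges:
  assumes "E \<noteq> {}"
    and pos: "\<And>t e. 0 \<le> t \<Longrightarrow> e \<in> E \<Longrightarrow> 0 < w t e"
    and init: "(\<Sum>e\<in>E. w 0 e) = 1"
    and flow: "\<And>t e. 0 \<le> t \<Longrightarrow> e \<in> E \<Longrightarrow> ((\<lambda>s. w s e) has_real_derivative
      - w t e * (face_curv E E (w t) e - (\<Sum>f\<in>E. w t f * face_curv E E (w t) f))) (at t within {0..})"
    and "e \<in> E"
  shows "\<exists>c. ((\<lambda>t. face_curv E E (w t) e) \<longlongrightarrow> c) at_top"
proof (rule normalized_flow_log_coordinates[of w, OF assms(1-4)])
  fix v assume v: "\<And>t e. 0 \<le> t \<Longrightarrow> e \<in> E \<Longrightarrow>
      ((\<lambda>s. v s e) has_real_derivative - gradient E (v t) e) (at t within {0..})"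
    "\<And>t e. 0 \<le> t \<Longrightarrow> e \<in> E \<Longrightarrow> gradient E (v t) e = face_curv E E (w t) e"
  obtain l where l: "((\<lambda>t. gradient E (v t) e) \<longlongrightarrow> l) at_top"
    using gradient_converges[of v e, OF v(1) \<open>e \<in> E\<close>] by blast
  have "\<forall>\<^sub>F t in at_top. gradient E (v t) e = face_curv E E (w t) e"
    by (rule eventually_mono[OF eventually_ge_at_top[of 0]]) (simp add: v(2) \<open>e \<in> E\<close>)
  then have "((\<lambda>t. face_curv E E (w t) e) \<longlongrightarrow> l) at_top"
    by (rule Lim_transform_eventually[OF l])
  then show ?thesis by blast
qed

text \<open>On the edges of minimal limiting curvature, \<open>v + c t\<close> follows the gradient flow of the face
  up to an exponentially small error, since \<open>exp (v\<^sub>f - v\<^sub>e)\<close> decays for \<open>f\<close> outside the face and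
  \<open>e\<close> inside.  A constant curvature metric on the face is a stationary point, so the distance to
  it stays bounded; any accumulation point is again stationary, hence is the limit.\<close>

lemma minimal_face_converges:
  assumes flow: "\<And>t e. 0 \<le> t \<Longrightarrow> e \<in> E \<Longrightarrow>
      ((\<lambda>s. v s e) has_real_derivative - gradient E (v t) e) (at t within {0..})"
    and lim: "\<And>e. e \<in> E \<Longrightarrow> ((\<lambda>t. gradient E (v t) e) \<longlongrightarrow> k e) at_top"
    and C: "C \<subseteq> E" "C \<noteq> {}" "\<And>e. e \<in> C \<Longrightarrow> k e = c" "\<And>e. e \<in> E - C \<Longrightarrow> c < k e"
    and p: "p \<in> const_curv_set E C c"
  obtains z where "\<And>e. e \<in> C \<Longrightarrow> ((\<lambda>t. v t e + c * t) \<longlongrightarrow> z e) at_top"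
    "\<And>e. e \<in> C \<Longrightarrow> gradient C z e = c"
    "\<And>e. e \<in> E - C \<Longrightarrow> ((\<lambda>t. exp (v t e + c * t)) \<longlongrightarrow> 0) at_top"
proof -
  have finC: "finite C" using finite_subset[OF C(1) finite_E] .
  define y where "y t e = v t e + c * t" for t e
  \<comment> \<open>A third of the curvature gap: an error below \<delta> at an edge inside and at
    one outside the face still leaves a separation rate of \<delta>. For \<open>C = E\<close> there
    is no gap and 1 is an arbitrary choice.\<close>
  obtain \<delta> where \<delta>: "0 < \<delta>" "\<And>e. e \<in> E - C \<Longrightarrow> c + 3 * \<delta> \<le> k e"
  proof (cases "E - C = {}")
    case False
    let ?m = "Min (k ` (E - C))"
    have "c < ?m" using False finite_E C(4) by (subst Min_gr_iff) auto
    show ?thesis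
    proof (rule that[of "(?m - c) / 3"])
      show "c + 3 * ((?m - c) / 3) \<le> k e" if "e \<in> E - C" for e
      proof -
        have "?m \<le> k e" using finite_E that by (intro Min_le) auto
        moreover have "3 * ((?m - c) / 3) = ?m - c" by simp
        ultimately show ?thesis by linarith
      qed
    qed (use \<open>c < ?m\<close> in simp)
  qed (use that[of 1] in auto)
  have "\<forall>\<^sub>F t in at_top. \<forall>e\<in>E. \<bar>gradient E (v t) e - k e\<bar> < \<delta>"
  proof (intro eventually_ball_finite finite_E ballI)
    fix e assume "e \<in> E"
    show "\<forall>\<^sub>F t in at_top. \<bar>gradient E (v t) e - k e\<bar> < \<delta>"
      using tendstoD[OF lim[OF \<open>e \<in> E\<close>] \<delta>(1)] by (simp add: dist_real_def)
  qed
  then obtain T0 where T0: "\<And>t e. T0 \<le> t \<Longrightarrow> e \<in> E \<Longrightarrow> \<bar>gradient E (v t) e - k e\<bar> < \<delta>"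
    by (auto simp: eventually_at_top_linorder)
  define T where "T = max T0 0"
  have T: "0 \<le> T" "\<And>t e. T \<le> t \<Longrightarrow> e \<in> E \<Longrightarrow> \<bar>gradient E (v t) e - k e\<bar> < \<delta>"
    using T0 by (auto simp: T_def)
  define M0 where "M0 = (\<Sum>e\<in>E. \<bar>v T e\<bar>)"
  have gap: "v t f - v t e \<le> 2 * M0 + \<delta> * T - \<delta> * t" if "T \<le> t" "e \<in> C" "f \<in> E - C" for t e f
  proof -
    have "v t f - v t e + \<delta> * t \<le> v T f - v T e + \<delta> * T"
    proof (rule nonincreasing_ray[where T = T and f = "\<lambda>t. v t f - v t e + \<delta> * t"])
      show "((\<lambda>t. v t f - v t e + \<delta> * t) has_real_derivative
          - gradient E (v t) f + gradient E (v t) e + \<delta>) (at t within {0..})" if "0 \<le> t" for t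
        using that \<open>e \<in> C\<close> \<open>f \<in> E - C\<close> C(1) by (auto intro!: derivative_eq_intros flow)
      show "- gradient E (v t) f + gradient E (v t) e + \<delta> \<le> 0" if "T \<le> t" for t
        using T(2)[OF that, of e] T(2)[OF that, of f] \<delta>(2)[OF \<open>f \<in> E - C\<close>] C(1) C(3)[OF \<open>e \<in> C\<close>]
          \<open>e \<in> C\<close> \<open>f \<in> E - C\<close> by (auto simp: abs_less_iff)
    qed (use that T in auto)
    moreover have "\<bar>v T f\<bar> \<le> M0" "\<bar>v T e\<bar> \<le> M0" unfolding M0_def
      using that C(1) finite_E by (auto intro!: member_le_sum[of _ E "\<lambda>e. \<bar>v T e\<bar>"])
    ultimately show ?thesis by linarith
  qed
  define D where "D = (\<Sum>x\<in>\<Union>E. \<bar>2 - real (degree E x)\<bar>)"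
  define M where "M = D * exp (2 * M0 + \<delta> * T)"
  define r where "r t e = gradient C (v t) e - gradient E (v t) e" for t e
  have err: "\<bar>r t e\<bar> \<le> M * exp (- \<delta> * t)" if "T \<le> t" "e \<in> C" for t e
  proof -
    have "\<bar>gradient E (v t) e - gradient C (v t) e\<bar> \<le> D * exp (2 * M0 + \<delta> * T - \<delta> * t)"
      unfolding D_def using that C(1) gap[OF that]
      by (intro face_curv_error) (auto simp: exp_diff[symmetric])
    then show ?thesis by (simp add: r_def M_def abs_minus_commute mult.assoc mult_exp_exp)
  qed
  have shift: "gradient C (y t) e = gradient C (v t) e" for t e
    using face_curv_scale[of "exp (c * t)" E C "\<lambda>f. exp (v t f)" e]
    by (simp add: y_def exp_add mult.commute)
  have dy: "((\<lambda>s. y s e) has_real_derivative r t e - (gradient C (y t) e - c)) (at t within {0..})"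
    if "0 \<le> t" "e \<in> C" for t e
    unfolding shift using that C(1) unfolding y_def r_def by (auto intro!: derivative_eq_intros flow)
  have mono: "0 \<le> (\<Sum>e\<in>C. (gradient C (y t) e - c) * (y t e - z e))"
    if "\<And>e. e \<in> C \<Longrightarrow> gradient C z e = c" for t z
  proof -
    have "(\<Sum>e\<in>C. (gradient C (y t) e - c) * (y t e - z e)) =
        (\<Sum>e\<in>C. (gradient C (y t) e - gradient C z e) * (y t e - z e))"
      using that by (intro sum.cong) auto
    then show ?thesis using gradient_monotone[OF C(1), of "y t" z] by simp
  qed
  have p_pos: "0 < p e" if "e \<in> C" for e
    using p that by (auto simp: const_curv_set_def open_simplex_def)
  have "gradient C (\<lambda>e. ln (p e)) e = c" if "e \<in> C" for e
  proof -
    have "gradient C (\<lambda>e. ln (p e)) e = face_curv E C p e"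
      using that p_pos by (intro face_curv_cong) auto
    then show ?thesis using p that by (simp add: const_curv_set_def)
  qed
  then obtain B where B: "\<forall>t\<ge>T. \<forall>e\<in>C. \<bar>y t e - ln (p e)\<bar> \<le> B"
    using perturbed_monotone_flow_bounded[where y = y and r = r and M = M and
      h = "\<lambda>t e. gradient C (y t) e - c" and z = "\<lambda>e. ln (p e)", OF finC T(1) \<delta>(1) dy mono err] by blast
  have "Bseq (\<lambda>n. y (T + real n) e)" if "e \<in> C" for e
  proof (rule BseqI')
    show "norm (y (T + real n) e) \<le> B + \<bar>ln (p e)\<bar>" for n
      using B[rule_format, of "T + real n", OF _ that] by simp
  qed
  then obtain \<sigma> where \<sigma>: "strict_mono \<sigma>" "\<forall>e\<in>C. convergent (\<lambda>n. y (T + real (\<sigma> n)) e)"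
    using bounded_family_convergent_subseq[OF finC, of "\<lambda>n. y (T + real n)"] by blast
  define \<tau> where "\<tau> n = T + real (\<sigma> n)" for n
  define z where "z e = lim (\<lambda>n. y (\<tau> n) e)" for e
  have \<tau>: "filterlim \<tau> at_top sequentially" unfolding \<tau>_def
    by (intro filterlim_tendsto_add_at_top[OF tendsto_const]
      filterlim_compose[OF filterlim_real_sequentially] filterlim_subseq \<sigma>(1))
  have z: "(\<lambda>n. y (\<tau> n) e) \<longlonglongrightarrow> z e" if "e \<in> C" for e
    using \<sigma>(2) that by (simp add: z_def \<tau>_def convergent_LIMSEQ_iff)
  have e0: "((\<lambda>t. exp (- \<delta> * t)) \<longlongrightarrow> 0) at_top"
    by (intro filterlim_compose[OF exp_at_bot] filterlim_tendsto_neg_mult_at_bot[OF tendsto_const _ filterlim_ident])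
      (use \<delta> in simp)
  \<comment> \<open>The face gradient tends to \<open>c\<close> along the whole flow, as the known
    limit of the full gradient plus a vanishing error. By continuity every accumulation point is
    therefore stationary.\<close>
  have grad_z: "gradient C z e = c" if "e \<in> C" for e
  proof -
    have "((\<lambda>t. r t e) \<longlongrightarrow> 0) at_top"
    proof (rule tendsto_zero_dominated)
      show "\<forall>\<^sub>F t in at_top. \<bar>r t e\<bar> \<le> M * exp (- \<delta> * t)"
        using err that by (auto simp: eventually_at_top_linorder)
      show "((\<lambda>t. M * exp (- \<delta> * t)) \<longlongrightarrow> 0) at_top" using tendsto_mult_left[OF e0, of M] by simp
    qed
    then have "((\<lambda>t. r t e + gradient E (v t) e) \<longlongrightarrow> 0 + k e) at_top"
      using that C(1) by (intro tendsto_add lim) auto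
    then have "((\<lambda>t. gradient C (y t) e) \<longlongrightarrow> c) at_top" using that C(3) by (simp add: r_def shift)
    then have "(\<lambda>n. gradient C (y (\<tau> n)) e) \<longlonglongrightarrow> c" using \<tau> by (rule filterlim_compose)
    moreover have "(\<lambda>n. gradient C (y (\<tau> n)) e) \<longlonglongrightarrow> gradient C z e"
      using that z by (intro tendsto_face_curv[OF C(1)] tendsto_exp) auto
    ultimately show ?thesis using LIMSEQ_unique by blast
  qed
  have conv: "((\<lambda>t. y t e) \<longlongrightarrow> z e) at_top" if "e \<in> C" for e
    using perturbed_monotone_flow_converges[where y = y and r = r and M = M and
      h = "\<lambda>t e. gradient C (y t) e - c" and z = z, OF finC T(1) \<delta>(1) dy mono err \<tau> z that] grad_z by blast
  have decay: "((\<lambda>t. exp (y t f)) \<longlongrightarrow> 0) at_top" if "f \<in> E - C" for f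
  proof -
    obtain e where "e \<in> C" using C(2) by blast
    have "((\<lambda>t. exp (y t e) * exp (2 * M0 + \<delta> * T) * exp (- \<delta> * t)) \<longlongrightarrow> exp (z e) * exp (2 * M0 + \<delta> * T) * 0) at_top"
      by (intro tendsto_intros conv e0 \<open>e \<in> C\<close>)
    then have 1: "((\<lambda>t. exp (y t e) * exp (2 * M0 + \<delta> * T) * exp (- \<delta> * t)) \<longlongrightarrow> 0) at_top" by simp
    have "\<bar>exp (y t f)\<bar> \<le> exp (y t e) * exp (2 * M0 + \<delta> * T) * exp (- \<delta> * t)" if "T \<le> t" for t
      using gap[OF that \<open>e \<in> C\<close> \<open>f \<in> E - C\<close>] by (simp add: mult_exp_exp y_def)
    then have "\<forall>\<^sub>F t in at_top. \<bar>exp (y t f)\<bar> \<le> exp (y t e) * exp (2 * M0 + \<delta> * T) * exp (- \<delta> * t)"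
      by (auto simp: eventually_at_top_linorder)
    then show ?thesis using 1 by (rule tendsto_zero_dominated)
  qed
  show ?thesis using that[of z] conv grad_z decay unfolding y_def by blast
qed

text \<open>Multiplying numerator and denominator of the exponential formula for \<open>w\<close> by
  \<open>exp (c * t)\<close> makes both converge, and the limit \<open>Z\<close> of the denominator
  is positive because the face is nonempty.\<close>

lemma normalized_flow_converges:
  assumes ne: "E \<noteq> {}"
    and pos: "\<And>t e. 0 \<le> t \<Longrightarrow> e \<in> E \<Longrightarrow> 0 < w t e"
    and init: "(\<Sum>e\<in>E. w 0 e) = 1"
    and flow: "\<And>t e. 0 \<le> t \<Longrightarrow> e \<in> E \<Longrightarrow> ((\<lambda>s. w s e) has_real_derivative
      - w t e * (face_curv E E (w t) e - (\<Sum>f\<in>E. w t f * face_curv E E (w t) f))) (at t within {0..})"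
    and lim: "\<And>e. e \<in> E \<Longrightarrow> ((\<lambda>t. face_curv E E (w t) e) \<longlongrightarrow> k e) at_top"
    and C: "C \<subseteq> E" "C \<noteq> {}" "\<And>e. e \<in> C \<Longrightarrow> k e = c" "\<And>e. e \<in> E - C \<Longrightarrow> c < k e"
    and nonempty: "const_curv_set E C c \<noteq> {}"
  obtains q where "\<And>e. e \<in> E \<Longrightarrow> ((\<lambda>t. w t e) \<longlongrightarrow> q e) at_top"
    "\<And>e. e \<in> C \<Longrightarrow> 0 < q e" "\<And>e. e \<in> E - C \<Longrightarrow> q e = 0"
    "restrict q C \<in> const_curv_set E C c"
proof -
  obtain v where v:
    "\<And>t e. 0 \<le> t \<Longrightarrow> e \<in> E \<Longrightarrow>
      ((\<lambda>s. v s e) has_real_derivative - gradient E (v t) e) (at t within {0..})"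
    "\<And>t e. 0 \<le> t \<Longrightarrow> e \<in> E \<Longrightarrow> w t e = exp (v t e) / (\<Sum>f\<in>E. exp (v t f))"
    "\<And>t e. 0 \<le> t \<Longrightarrow> e \<in> E \<Longrightarrow> gradient E (v t) e = face_curv E E (w t) e"
    using normalized_flow_log_coordinates[of w, OF ne pos init flow] by blast
  have ev0: "\<forall>\<^sub>F t in at_top. 0 \<le> (t::real)" by (rule eventually_ge_at_top)
  have "((\<lambda>t. gradient E (v t) e) \<longlongrightarrow> k e) at_top" if "e \<in> E" for e
    by (rule Lim_transform_eventually[OF lim[OF that] eventually_mono[OF ev0]]) (simp add: v that)
  moreover obtain p where "p \<in> const_curv_set E C c" using nonempty by blast
  ultimately obtain z where z: "\<And>e. e \<in> C \<Longrightarrow> ((\<lambda>t. v t e + c * t) \<longlongrightarrow> z e) at_top"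
    "\<And>e. e \<in> C \<Longrightarrow> gradient C z e = c"
    "\<And>e. e \<in> E - C \<Longrightarrow> ((\<lambda>t. exp (v t e + c * t)) \<longlongrightarrow> 0) at_top"
    using minimal_face_converges[of v k C c, OF v(1) _ C] by blast
  define a where "a e = (if e \<in> C then exp (z e) else 0)" for e
  define Z where "Z = (\<Sum>f\<in>E. a f)"
  define q where "q e = a e / Z" for e
  have finC: "finite C" using finite_subset[OF C(1) finite_E] .
  have Z_eq: "Z = (\<Sum>f\<in>C. exp (z f))"
    unfolding Z_def a_def using C(1) finite_E by (simp add: sum.If_cases Int_absorb1)
  then have "0 < Z" using finC C(2) by (simp add: sum_pos)
  have lim_a: "((\<lambda>t. exp (v t e + c * t)) \<longlongrightarrow> a e) at_top" if "e \<in> E" for e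
    using z(3)[of e] tendsto_exp[OF z(1), of e] that by (auto simp: a_def)
  have "((\<lambda>t. w t e) \<longlongrightarrow> q e) at_top" if "e \<in> E" for e
  proof (rule Lim_transform_eventually)
    show "((\<lambda>t. exp (v t e + c * t) / (\<Sum>f\<in>E. exp (v t f + c * t))) \<longlongrightarrow> q e) at_top"
      unfolding q_def Z_def using \<open>0 < Z\<close>[unfolded Z_def] by (intro tendsto_intros lim_a that) auto
    show "\<forall>\<^sub>F t in at_top. exp (v t e + c * t) / (\<Sum>f\<in>E. exp (v t f + c * t)) = w t e"
      by (rule eventually_mono[OF ev0]) (simp add: v(2) that exp_add sum_distrib_right[symmetric])
  qed
  moreover have "0 < q e" if "e \<in> C" for e using that \<open>0 < Z\<close> by (simp add: q_def a_def)
  moreover have "q e = 0" if "e \<in> E - C" for e using that by (simp add: q_def a_def)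
  moreover have "restrict q C \<in> const_curv_set E C c"
  proof -
    have "face_curv E C (restrict q C) e = c" if "e \<in> C" for e
    proof -
      have "face_curv E C (restrict q C) e = face_curv E C (\<lambda>f. (1 / Z) * exp (z f)) e"
        using that by (intro face_curv_cong) (auto simp: q_def a_def)
      also have "\<dots> = c" using \<open>0 < Z\<close> z(2)[OF that] by (subst face_curv_scale) auto
      finally show ?thesis .
    qed
    moreover have "(\<Sum>e\<in>C. restrict q C e) = 1"
      using \<open>0 < Z\<close> by (simp add: q_def a_def sum_divide_distrib[symmetric] Z_eq[symmetric])
    ultimately show ?thesis using \<open>\<And>e. e \<in> C \<Longrightarrow> 0 < q e\<close>
      by (auto simp: const_curv_set_def open_simplex_def)
  qed
  ultimately show ?thesis using that by blast
qed

text \<open>Along \<tau> the weights outside \<open>C\<close> become negligible against those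
  inside, so the full and the face curvature have the same limit on \<open>C\<close>; the former
  tends to \<open>c\<close>.\<close>

lemma omega_limit_const_curv:
  assumes pos: "\<And>t e. 0 \<le> t \<Longrightarrow> e \<in> E \<Longrightarrow> 0 < w t e"
    and lim: "\<And>e. e \<in> C \<Longrightarrow> ((\<lambda>t. face_curv E E (w t) e) \<longlongrightarrow> c) at_top"
    and q: "omega_limit_point E w q" "pos_support E q = C"
  shows "restrict q C \<in> const_curv_set E C c"
proof -
  obtain \<tau> where \<tau>: "filterlim \<tau> at_top sequentially" "\<And>e. e \<in> E \<Longrightarrow> (\<lambda>j. w (\<tau> j) e) \<longlonglongrightarrow> q e"
    using q(1) unfolding omega_limit_point_def by blast
  have C: "C \<subseteq> E" "\<And>e. e \<in> C \<Longrightarrow> 0 < q e" using q(2) by (auto simp: pos_support_def)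
  have q0: "q e = 0" if "e \<in> E - C" for e
    using q that unfolding omega_limit_point_def pos_support_def by force
  have sum: "(\<Sum>e\<in>C. q e) = 1"
    using q(1) q0 C(1) finite_E sum.mono_neutral_left[of E C q] by (simp add: omega_limit_point_def)
  have "face_curv E C q e = c" if "e \<in> C" for e
  proof -
    define D where "D = (\<Sum>x\<in>\<Union>E. \<bar>2 - real (degree E x)\<bar>)"
    define \<eta> where "\<eta> j = (\<Sum>f\<in>E - C. w (\<tau> j) f / w (\<tau> j) e)" for j
    have e: "e \<in> E" "q e \<noteq> 0" using that C by force+
    have ev: "\<forall>\<^sub>F j in sequentially. 0 \<le> \<tau> j" using \<tau>(1) by (simp add: filterlim_at_top)
    have "\<eta> \<longlonglongrightarrow> (\<Sum>f\<in>E - C. q f / q e)" unfolding \<eta>_def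
      using e by (intro tendsto_intros \<tau>(2)) auto
    then have "(\<lambda>j. D * \<eta> j) \<longlonglongrightarrow> 0" using q0 tendsto_mult_left[of \<eta> 0 _ D] by simp
    moreover have "\<forall>\<^sub>F j in sequentially. \<bar>face_curv E E (w (\<tau> j)) e - face_curv E C (w (\<tau> j)) e\<bar> \<le> D * \<eta> j"
      using ev
    proof eventually_elim
      case (elim j)
      have nn: "0 \<le> w (\<tau> j) f / w (\<tau> j) e" if "f \<in> E" for f
        using pos[OF elim] that e by (simp add: less_imp_le)
      have "w (\<tau> j) f / w (\<tau> j) e \<le> \<eta> j" if "f \<in> E - C" for f
        unfolding \<eta>_def using that finite_E nn by (intro member_le_sum) auto
      moreover have "0 \<le> \<eta> j" unfolding \<eta>_def using nn by (intro sum_nonneg) auto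
      ultimately show ?case
        unfolding D_def using pos[OF elim] by (intro face_curv_error C(1) that) auto
    qed
    ultimately have "(\<lambda>j. face_curv E E (w (\<tau> j)) e - face_curv E C (w (\<tau> j)) e) \<longlonglongrightarrow> 0"
      by (rule tendsto_zero_dominated[rotated])
    moreover have "(\<lambda>j. face_curv E E (w (\<tau> j)) e - face_curv E C (w (\<tau> j)) e)
        \<longlonglongrightarrow> c - face_curv E C q e"
    proof (rule tendsto_diff)
      show "(\<lambda>j. face_curv E E (w (\<tau> j)) e) \<longlonglongrightarrow> c"
        using lim[OF that] \<tau>(1) by (rule filterlim_compose)
      show "(\<lambda>j. face_curv E C (w (\<tau> j)) e) \<longlonglongrightarrow> face_curv E C q e"
        using C by (intro tendsto_face_curv[OF C(1) that] \<tau>(2)) auto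
    qed
    ultimately have "c - face_curv E C q e = 0" using LIMSEQ_unique by blast
    then show ?thesis by simp
  qed
  moreover have "face_curv E C (restrict q C) e = face_curv E C q e" if "e \<in> C" for e
    using that by (intro face_curv_cong) auto
  ultimately show ?thesis using C sum by (auto simp: const_curv_set_def open_simplex_def)
qed

end

theorem theorem1p8:
  fixes V :: "'a set" and E :: "'a set set" and w :: "real \<Rightarrow> 'a set \<Rightarrow> real"
  assumes tree: "finite_tree V E"
    and edge: "E \<noteq> {}"
    and flow: "normalized_flow V E w"
  defines "Es \<equiv> min_edges V E w"
    and "S \<equiv> const_curv_set E (min_edges V E w) (min_lim_curv V E w)"
  shows "(S \<noteq> {} \<longrightarrow>
           (\<exists>winf :: 'a set \<Rightarrow> real.
              (\<forall>e\<in>E. ((\<lambda>t. w t e) \<longlongrightarrow> winf e) at_top) \<and>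
              pos_support E winf = Es \<and>
              restrict winf Es \<in> S \<and>
              (\<forall>e\<in>Es. \<forall>f\<in>Es. ((\<lambda>t. w t e / w t f) \<longlongrightarrow> winf e / winf f) at_top \<and>
                 0 < winf e / winf f))) \<and>
         (\<forall>q. omega_limit_point E w q \<and> pos_support E q = Es \<longrightarrow>
              (\<forall>e\<in>E. ((\<lambda>t. w t e) \<longlongrightarrow> q e) at_top))"
proof -
  have G: "finite_graph V E" using tree by (simp add: finite_tree_def)
  interpret finite_edges E
  proof
    show "finite E" by (rule finite_graph_finite_edges[OF G])
    show "\<forall>e\<in>E. finite e" using G by (auto simp: finite_graph_def)
  qed
  have pos: "0 < w t e" if "0 \<le> t" "e \<in> E" for t e
    using flow that by (simp add: normalized_flow_def)
  have init: "(\<Sum>e\<in>E. w 0 e) = 1" using flow by (simp add: normalized_flow_def)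
  have curv: "curv V E (w t) e = face_curv E E (w t) e" if "0 \<le> t" "e \<in> E" for t e
    using pos[OF that(1)] that(2) by (intro curv_tree[OF tree]) auto
  have flow': "((\<lambda>s. w s e) has_real_derivative
      - w t e * (face_curv E E (w t) e - (\<Sum>f\<in>E. w t f * face_curv E E (w t) f))) (at t within {0..})"
    if "0 \<le> t" "e \<in> E" for t e
  proof -
    have "mean_curv V E (w t) = (\<Sum>f\<in>E. w t f * face_curv E E (w t) f)"
      unfolding mean_curv_def by (intro sum.cong) (auto simp: curv that)
    moreover have "((\<lambda>s. w s e) has_real_derivative
        - w t e * (curv V E (w t) e - mean_curv V E (w t))) (at t within {0..})"
      using flow that unfolding normalized_flow_def by blast
    ultimately show ?thesis by (simp only: curv[OF that])
  qed
  have ev0: "\<forall>\<^sub>F t in at_top. 0 \<le> (t::real)" by (rule eventually_ge_at_top)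
  define k where "k = lim_curv V E w"
  \<comment> \<open>\<open>lim_curv\<close> is a \<open>Lim\<close> and carries information only
    once convergence is established.\<close>
  have lim: "((\<lambda>t. face_curv E E (w t) e) \<longlongrightarrow> k e) at_top" if e: "e \<in> E" for e
  proof -
    obtain l where 1: "((\<lambda>t. face_curv E E (w t) e) \<longlongrightarrow> l) at_top"
      using normalized_flow_curvature_converges[of w e, OF edge pos init flow' e] by auto
    have "((\<lambda>t. curv V E (w t) e) \<longlongrightarrow> l) at_top"
      by (rule Lim_transform_eventually[OF 1 eventually_mono[OF ev0]]) (simp add: curv that)
    then have "k e = l" unfolding k_def lim_curv_def by (intro tendsto_Lim) auto
    then show ?thesis using 1 by simp
  qed
  define c where "c = min_lim_curv V E w"
  have c_def': "c = Min (k ` E)" by (simp add: c_def min_lim_curv_def k_def)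
  have Es: "Es = {e \<in> E. k e = c}" by (simp add: Es_def min_edges_def k_def c_def)
  have S: "S = const_curv_set E Es c" by (simp add: S_def Es_def c_def)
  have C: "Es \<subseteq> E" "Es \<noteq> {}" "\<And>e. e \<in> Es \<Longrightarrow> k e = c" "\<And>e. e \<in> E - Es \<Longrightarrow> c < k e"
  proof -
    have "c \<in> k ` E" unfolding c_def' using finite_E edge by (intro Min_in) auto
    then show "Es \<noteq> {}" by (auto simp: Es)
    show "c < k e" if "e \<in> E - Es" for e
    proof -
      have "c \<le> k e" unfolding c_def' using that finite_E by (intro Min_le) auto
      moreover have "k e \<noteq> c" using that by (auto simp: Es)
      ultimately show ?thesis by simp
    qed
  qed (auto simp: Es)
  have main: "\<exists>winf. (\<forall>e\<in>E. ((\<lambda>t. w t e) \<longlongrightarrow> winf e) at_top) \<and> (\<forall>e\<in>Es. 0 < winf e) \<and>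
      (\<forall>e\<in>E - Es. winf e = 0) \<and> restrict winf Es \<in> S" if "S \<noteq> {}"
  proof (rule normalized_flow_converges[of w k Es c, OF edge pos init flow' lim C])
    show "const_curv_set E Es c \<noteq> {}" using that unfolding S .
  qed (unfold S, blast+)
  show ?thesis
  proof (intro conjI allI impI)
    assume "S \<noteq> {}"
    then obtain winf where winf: "\<forall>e\<in>E. ((\<lambda>t. w t e) \<longlongrightarrow> winf e) at_top" "\<forall>e\<in>Es. 0 < winf e"
      "\<forall>e\<in>E - Es. winf e = 0" "restrict winf Es \<in> S" using main by blast
    have "pos_support E winf = Es" using winf(2,3) C(1) by (force simp: pos_support_def)
    moreover have "((\<lambda>t. w t e / w t f) \<longlongrightarrow> winf e / winf f) at_top" "0 < winf e / winf f"
      if "e \<in> Es" "f \<in> Es" for e f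
      using that winf C(1) by (force intro!: tendsto_divide, simp)
    ultimately show "\<exists>winf. (\<forall>e\<in>E. ((\<lambda>t. w t e) \<longlongrightarrow> winf e) at_top) \<and> pos_support E winf = Es \<and>
        restrict winf Es \<in> S \<and> (\<forall>e\<in>Es. \<forall>f\<in>Es. ((\<lambda>t. w t e / w t f) \<longlongrightarrow> winf e / winf f) at_top \<and>
          0 < winf e / winf f)"
      using winf(1,4) by blast
  next
    fix q assume q: "omega_limit_point E w q \<and> pos_support E q = Es"
    \<comment> \<open>The omega-limit point itself witnesses that \<open>S\<close> is nonempty. So
      the flow converges, and comparison along \<tau> identifies the limit as
      \<open>q\<close>.\<close>
    have "restrict q Es \<in> S" unfolding S
      using q lim C by (intro omega_limit_const_curv[where w = w] pos) auto
    then obtain winf where winf: "\<forall>e\<in>E. ((\<lambda>t. w t e) \<longlongrightarrow> winf e) at_top" using main by blast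
    obtain \<tau> where \<tau>: "filterlim \<tau> at_top sequentially" "\<forall>e\<in>E. (\<lambda>j. w (\<tau> j) e) \<longlonglongrightarrow> q e"
      using q unfolding omega_limit_point_def by blast
    show "\<forall>e\<in>E. ((\<lambda>t. w t e) \<longlongrightarrow> q e) at_top"
    proof
      fix e assume "e \<in> E"
      then have "(\<lambda>j. w (\<tau> j) e) \<longlonglongrightarrow> winf e" using winf \<tau>(1) by (auto intro: filterlim_compose)
      then have "q e = winf e" using \<tau>(2) \<open>e \<in> E\<close> LIMSEQ_unique by blast
      then show "((\<lambda>t. w t e) \<longlongrightarrow> q e) at_top" using winf \<open>e \<in> E\<close> by simp
    qed
  qed
qed

end
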